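(* Let $K$ be a non-compact locally compact hypergroup with a left Haar measure $\omega$ and let $\sigma$ be a non-degenerate probability measure on $K$. Then $H^p_\sigma(K)=\{0\}$ for all $1<p<\infty$.
   Context: $K$ is a locally compact hypergroup (Jewett/Bloom–Heyer sense) with involution $x\mapsto\check x$ and left Haar measure $\omega$ (nonzero positive Radon measure with $\delta_x*\omega=\omega$ for all $x$); $L^p(K)$ is taken with respect to $\omega$. For a Borel function $f$, $f(x*y)=\int_K f\,d(\delta_x*\delta_y)$, and for $\mu\in M(K)$, $(\mu*f)(x)=\int_K f(\check y*x)\,d\mu(y)$. $H^p_\sigma(K)=\{f\in L^p(K):\sigma*f=f\}$. For subsets $A,B\subseteq K$, $A*B=\bigcup_{a\in A,b\in B}\operatorname{supp}(\delta_a*\delta_b)$ and $A^n$ is the $n$-fold product. A measure $\mu\in M(K)$ is non-degenerate if $K=\overline{\bigcup_{n\geq1}(\operatorname{supp}|\mu|)^n}$. *)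

theory Defs
  imports "HOL-Analysis.Analysis" "HOL-Probability.Probability"
begin

section \<open>Locally compact hypergroups (Jewett / Bloom--Heyer)\<close>

text \<open>A hypergroup structure on a type 'a is given by the convolution of point
  measures conv x y (standing for delta_x * delta_y), an involution invol and a
  neutral element e.\<close>

definition msupp :: "'a::topological_space measure \<Rightarrow> 'a set" where
  "msupp M = {x. \<forall>U. open U \<longrightarrow> x \<in> U \<longrightarrow> emeasure M U \<noteq> 0}"

definition radon :: "'a::topological_space measure \<Rightarrow> bool" where
  "radon M \<longleftrightarrow> sets M = sets borel
     \<and> (\<forall>C. compact C \<longrightarrow> emeasure M C < \<infinity>)
     \<and> (\<forall>A\<in>sets borel. emeasure M A = (INF U\<in>{U. open U \<and> A \<subseteq> U}. emeasure M U))
     \<and> (\<forall>U. open U \<longrightarrow> emeasure M U = (SUP C\<in>{C. compact C \<and> C \<subseteq> U}. emeasure M C))"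

definition Cc :: "('a::topological_space \<Rightarrow> real) set" where
  "Cc = {f. continuous_on UNIV f \<and> compact (closure {x. f x \<noteq> 0})}"

definition hypergroup ::
  "('a::t2_space \<Rightarrow> 'a \<Rightarrow> 'a measure) \<Rightarrow> ('a \<Rightarrow> 'a) \<Rightarrow> 'a \<Rightarrow> bool" where
  "hypergroup conv invol e \<longleftrightarrow>
     \<comment> \<open>delta_x * delta_y is a Radon probability measure with compact support\<close>
     (\<forall>x y. prob_space (conv x y) \<and> radon (conv x y) \<and> compact (msupp (conv x y)))
     \<comment> \<open>associativity: (delta_x * delta_y) * delta_z = delta_x * (delta_y * delta_z)\<close>
   \<and> (\<forall>x y z. \<forall>f\<in>Cc.
        (\<integral>u. (\<integral>t. f t \<partial>conv u z) \<partial>conv x y) = (\<integral>v. (\<integral>t. f t \<partial>conv x v) \<partial>conv y z))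
     \<comment> \<open>continuity of (x,y) |-> delta_x * delta_y into M^1(K) with the vague topology\<close>
   \<and> (\<forall>f\<in>Cc. continuous_on UNIV (\<lambda>(x,y). \<integral>t. f t \<partial>conv x y))
     \<comment> \<open>neutral element\<close>
   \<and> (\<forall>x. conv e x = return borel x \<and> conv x e = return borel x)
     \<comment> \<open>involution: homeomorphism of order 2, anti-automorphism of convolution\<close>
   \<and> continuous_on UNIV invol \<and> (\<forall>x. invol (invol x) = x)
   \<and> (\<forall>x y. distr (conv x y) borel invol = conv (invol y) (invol x))
     \<comment> \<open>e in supp(delta_x * delta_y) iff x = invol y\<close>
   \<and> (\<forall>x y. e \<in> msupp (conv x y) \<longleftrightarrow> x = invol y)
     \<comment> \<open>continuity of (x,y) |-> supp(delta_x * delta_y) in the Michael (Vietoris) topology\<close>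
   \<and> (\<forall>U. open U \<longrightarrow> open {(x,y). msupp (conv x y) \<subseteq> U}
                  \<and> open {(x,y). msupp (conv x y) \<inter> U \<noteq> {}})"

definition left_haar ::
  "('a::t2_space \<Rightarrow> 'a \<Rightarrow> 'a measure) \<Rightarrow> 'a measure \<Rightarrow> bool" where
  "left_haar conv \<omega> \<longleftrightarrow> radon \<omega> \<and> emeasure \<omega> UNIV \<noteq> 0
     \<and> (\<forall>x. \<forall>f\<in>Cc. (\<integral>y. (\<integral>t. f t \<partial>conv x y) \<partial>\<omega>) = (\<integral>y. f y \<partial>\<omega>))"

text \<open>Subset products A * B and powers A^n (n >= 1; A^0 is unused).\<close>
definition set_conv :: "('a::topological_space \<Rightarrow> 'a \<Rightarrow> 'a measure) \<Rightarrow> 'a set \<Rightarrow> 'a set \<Rightarrow> 'a set" where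
  "set_conv conv A B = (\<Union>a\<in>A. \<Union>b\<in>B. msupp (conv a b))"

fun set_pow :: "('a::topological_space \<Rightarrow> 'a \<Rightarrow> 'a measure) \<Rightarrow> 'a set \<Rightarrow> nat \<Rightarrow> 'a set" where
  "set_pow conv A 0 = UNIV"
| "set_pow conv A (Suc 0) = A"
| "set_pow conv A (Suc (Suc n)) = set_conv conv (set_pow conv A (Suc n)) A"

text \<open>Non-degenerate measure (here for a positive measure, so |sigma| = sigma).\<close>
definition non_degenerate :: "('a::topological_space \<Rightarrow> 'a \<Rightarrow> 'a measure) \<Rightarrow> 'a measure \<Rightarrow> bool" where
  "non_degenerate conv \<sigma> \<longleftrightarrow> UNIV = closure (\<Union>n\<in>{1..}. set_pow conv (msupp \<sigma>) n)"

definition fconv :: "('a::topological_space \<Rightarrow> 'a \<Rightarrow> 'a measure) \<Rightarrow> ('a \<Rightarrow> complex) \<Rightarrow> 'a \<Rightarrow> 'a \<Rightarrow> complex" where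
  "fconv conv f x y = (\<integral>t. f t \<partial>conv x y)"

definition mconv :: "('a::topological_space \<Rightarrow> 'a \<Rightarrow> 'a measure) \<Rightarrow> ('a \<Rightarrow> 'a) \<Rightarrow> 'a measure \<Rightarrow> ('a \<Rightarrow> complex) \<Rightarrow> 'a \<Rightarrow> complex" where
  "mconv conv invol \<mu> f x = (\<integral>y. fconv conv f (invol y) x \<partial>\<mu>)"

text \<open>H^p_sigma(K) as a set of (Borel representatives of) L^p functions.\<close>
definition Hp :: "('a::topological_space \<Rightarrow> 'a \<Rightarrow> 'a measure) \<Rightarrow> ('a \<Rightarrow> 'a) \<Rightarrow> 'a measure \<Rightarrow> real \<Rightarrow> 'a measure \<Rightarrow> ('a \<Rightarrow> complex) set" where
  "Hp conv invol \<omega> p \<sigma> = {f. f \<in> borel_measurable borel \<and> integrable \<omega> (\<lambda>x. norm (f x) powr p)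
        \<and> (AE x in \<omega>. mconv conv invol \<sigma> f x = f x)}"

end

theory Submission
  imports Defs
begin

text \<open>
  Write \<open>T h x = (\<integral>y. h (invol y * x) \<partial>\<sigma>)\<close>. By left invariance, \<open>T\<close> preserves the \<open>\<omega>\<close>-integral of
  nonnegative functions. If \<open>T f = f\<close> with \<open>f\<close> in \<open>L\<^sup>p\<close>, then \<open>h = max 0 (|f| - c)\<close> is
  integrable for \<open>c > 0\<close> and \<open>h \<le> T h\<close>; equality of the integrals forces \<open>T h = h\<close> almost everywhere,
  so the set \<open>A = {x. |f x| > c}\<close>, of finite measure, satisfies \<open>T 1\<^sub>A = 1\<^sub>A\<close>.
  The mass that translation by \<open>y\<close> moves out of \<open>A\<close> is a lower semicontinuous function of \<open>y\<close> whose
  \<open>\<sigma>\<close>-average vanishes. It therefore vanishes on the support of \<open>\<sigma>\<close>, then by associativity on all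
  products of supports, and by non-degeneracy everywhere. Translating by an element far away moves
  any compact subset of \<open>A\<close> off itself, so that \<open>A\<close> is null.

  Since \<open>\<omega>\<close> need not be \<open>\<sigma>\<close>-finite and the space need not be second countable, all interchanges
  of integrals are done for lower semicontinuous integrands and then transferred to Borel sets inside
  open sets of finite measure.
\<close>

section \<open>Lower semicontinuous functions and Radon measures\<close>

definition lower_semicont :: "('a::topological_space \<Rightarrow> ennreal) \<Rightarrow> bool" where
  "lower_semicont f \<longleftrightarrow> (\<forall>t. open {x. t < f x})"

lemma lower_semicontD: "lower_semicont f \<Longrightarrow> open {x. t < f x}"
  by (simp add: lower_semicont_def)

lemma lower_semicontI_local:
  assumes "\<And>x. \<exists>W. open W \<and> x \<in> W \<and> (\<forall>y\<in>W. f x \<le> f y)"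
  shows "lower_semicont f"
  unfolding lower_semicont_def
proof (intro allI, subst open_subopen, intro ballI)
  fix t x assume "x \<in> {x. t < f x}"
  then show "\<exists>W. open W \<and> x \<in> W \<and> W \<subseteq> {x. t < f x}"
    using assms[of x] by (force intro: less_le_trans)
qed

lemma lower_semicont_SUP:
  assumes "\<And>i. i \<in> I \<Longrightarrow> lower_semicont (F i)"
  shows "lower_semicont (\<lambda>x. SUP i\<in>I. F i x)"
proof -
  have "{x. t < (SUP i\<in>I. F i x)} = (\<Union>i\<in>I. {x. t < F i x})" for t
    by (auto simp: less_SUP_iff)
  then show ?thesis
    using assms by (auto simp: lower_semicont_def)
qed

lemma lower_semicont_compose:
  assumes "lower_semicont f" and "continuous_on UNIV g"
  shows "lower_semicont (\<lambda>x. f (g x))"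
proof -
  have "open (g -` {x. t < f x})" for t
    using assms by (intro open_vimage lower_semicontD)
  then show ?thesis
    by (simp add: lower_semicont_def vimage_def)
qed

lemma lower_semicont_measurable:
  assumes "lower_semicont f"
  shows "f \<in> borel_measurable borel"
  by (rule borel_measurableI_greater) (use assms in \<open>auto simp: lower_semicont_def\<close>)

lemma lower_semicont_continuous:
  assumes "continuous_on UNIV (f :: 'a::topological_space \<Rightarrow> real)"
  shows "lower_semicont (\<lambda>x. ennreal (f x))"
proof -
  have "open {x. t < ennreal (f x)}" for t
  proof (cases t)
    case (real r)
    then have "{x. t < ennreal (f x)} = {x. r < f x}"
      by (auto simp: ennreal_less_iff)
    then show ?thesis
      using assms by (auto intro!: open_Collect_less)
  qed auto
  then show ?thesis
    by (simp add: lower_semicont_def)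
qed

lemma lower_semicont_indicator_times:
  assumes "open U" and "lower_semicont f"
  shows "lower_semicont (\<lambda>x. indicator U x * f x)"
proof -
  have "{x. t < indicator U x * f x} = U \<inter> {x. t < f x}" for t
    by (auto simp: indicator_def split: if_splits)
  then show ?thesis
    using assms by (auto simp: lower_semicont_def)
qed

lemma radon_sets: "radon M \<Longrightarrow> sets M = sets borel"
  by (simp add: radon_def)

lemma radon_space: "radon M \<Longrightarrow> space M = UNIV"
  by (metis radon_sets sets_eq_imp_space_eq space_borel)

lemma radon_emeasure_open:
  "radon M \<Longrightarrow> open U \<Longrightarrow> emeasure M U = (SUP C\<in>{C. compact C \<and> C \<subseteq> U}. emeasure M C)"
  unfolding radon_def by blast

lemma finite_directed_upper_bound:
  assumes "finite J" "J \<subseteq> I" "I \<noteq> {}"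
    and dir: "\<And>i j. i \<in> I \<Longrightarrow> j \<in> I \<Longrightarrow> \<exists>k\<in>I. F i \<le> F k \<and> F j \<le> F k"
  shows "\<exists>k\<in>I. \<forall>i\<in>J. F i \<le> (F k :: 'b::preorder)"
  using assms(1,2)
proof (induction rule: finite_induct)
  case empty
  then show ?case using \<open>I \<noteq> {}\<close> by auto
next
  case (insert a J)
  then obtain k where k: "k \<in> I" "\<forall>i\<in>J. F i \<le> F k" by auto
  obtain l where "l \<in> I" "F a \<le> F l" "F k \<le> F l"
    using dir[of a k] insert k by auto
  then show ?case
    using k by (intro bexI[of _ l]) (auto intro: order_trans)
qed

lemma emeasure_directed_UN_open:
  assumes M: "radon M" and ne: "I \<noteq> {}"
    and op: "\<And>i. i \<in> I \<Longrightarrow> open (O' i)"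
    and dir: "\<And>i j. i \<in> I \<Longrightarrow> j \<in> I \<Longrightarrow> \<exists>k\<in>I. O' i \<subseteq> O' k \<and> O' j \<subseteq> O' k"
  shows "emeasure M (\<Union>i\<in>I. O' i) = (SUP i\<in>I. emeasure M (O' i))"
proof (rule antisym)
  have "emeasure M C \<le> (SUP i\<in>I. emeasure M (O' i))"
    if C: "compact C" "C \<subseteq> (\<Union>i\<in>I. O' i)" for C
  proof -
    obtain J where J: "J \<subseteq> I" "finite J" "C \<subseteq> (\<Union>i\<in>J. O' i)"
      using compactE_image[OF C(1), of I O'] op C(2) by auto
    obtain k where k: "k \<in> I" "\<forall>i\<in>J. O' i \<subseteq> O' k"
      using finite_directed_upper_bound[OF J(2,1) ne dir] by auto
    then have "emeasure M C \<le> emeasure M (O' k)"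
      using J(3) op[of k] by (intro emeasure_mono) (fastforce, auto simp: radon_sets[OF M])
    also have "\<dots> \<le> (SUP i\<in>I. emeasure M (O' i))"
      using k by (intro SUP_upper)
    finally show ?thesis .
  qed
  then show "emeasure M (\<Union>i\<in>I. O' i) \<le> (SUP i\<in>I. emeasure M (O' i))"
    using op by (subst radon_emeasure_open[OF M]) (auto intro!: SUP_least)
  show "(SUP i\<in>I. emeasure M (O' i)) \<le> emeasure M (\<Union>i\<in>I. O' i)"
    using op by (intro SUP_least emeasure_mono) (auto simp: radon_sets[OF M] intro!: borel_open)
qed

text \<open>For every rational level \<open>q\<close> a sequence of the family exhausts the measure of
  \<open>{x. q < sup F x}\<close>; an increasing sequence dominating all of these has the full supremum
  almost everywhere, so that monotone convergence applies.\<close>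

lemma nn_integral_SUP_directed:
  fixes F :: "'i \<Rightarrow> 'a::topological_space \<Rightarrow> ennreal"
  assumes M: "radon M" and ne: "I \<noteq> {}"
    and dir: "\<And>i j. i \<in> I \<Longrightarrow> j \<in> I \<Longrightarrow> \<exists>k\<in>I. F i \<le> F k \<and> F j \<le> F k"
    and lsc: "\<And>i. i \<in> I \<Longrightarrow> lower_semicont (F i)"
  shows "(\<integral>\<^sup>+x. (SUP i\<in>I. F i x) \<partial>M) = (SUP i\<in>I. \<integral>\<^sup>+x. F i x \<partial>M)"
proof (rule antisym)
  show "(SUP i\<in>I. \<integral>\<^sup>+x. F i x \<partial>M) \<le> (\<integral>\<^sup>+x. (SUP i\<in>I. F i x) \<partial>M)"
    by (intro SUP_least nn_integral_mono) (auto intro: SUP_upper)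
  define s where "s = (SUP i\<in>I. \<integral>\<^sup>+x. F i x \<partial>M)"
  define G where "G x = (SUP i\<in>I. F i x)" for x
  show "(\<integral>\<^sup>+x. (SUP i\<in>I. F i x) \<partial>M) \<le> (SUP i\<in>I. \<integral>\<^sup>+x. F i x \<partial>M)"
    unfolding s_def[symmetric] G_def[symmetric]
  proof (cases "s = \<infinity>")
    case False
    note sets = radon_sets[OF M] radon_space[OF M]
    have meas [measurable]: "F i \<in> borel_measurable M" if "i \<in> I" for i
      using lower_semicont_measurable[OF lsc[OF that]] sets by (simp cong: measurable_cong_sets)
    have lscG: "lower_semicont G"
      unfolding G_def using lsc by (rule lower_semicont_SUP)
    have op: "{x. q < F i x} \<in> sets M" if "i \<in> I" for i q
      using lower_semicontD[OF lsc[OF that]] sets by auto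
    define Q where "Q = {ennreal (of_rat r) | r. 0 < r}"
    have Qc: "countable Q"
    proof -
      have "Q = (\<lambda>r. ennreal (of_rat r)) ` {r. 0 < r}" by (auto simp: Q_def)
      then show ?thesis by simp
    qed
    have Qne: "Q \<noteq> {}" by (auto simp: Q_def intro: exI[of _ 1])
    have level: "emeasure M {x. q < G x} = (SUP i\<in>I. emeasure M {x. q < F i x})" for q
    proof -
      have "{x. q < G x} = (\<Union>i\<in>I. {x. q < F i x})"
        by (auto simp: G_def less_SUP_iff)
      then show ?thesis
      proof (simp only:, intro emeasure_directed_UN_open[OF M ne])
        fix i j assume "i \<in> I" "j \<in> I"
        then obtain k where "k \<in> I" "F i \<le> F k" "F j \<le> F k" using dir by blast
        then show "\<exists>k\<in>I. {x. q < F i x} \<subseteq> {x. q < F k x} \<and> {x. q < F j x} \<subseteq> {x. q < F k x}"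
          by (intro bexI[of _ k]) (auto simp: le_fun_def intro: less_le_trans)
      qed (use lsc in \<open>auto simp: lower_semicont_def\<close>)
    qed
    have fin: "emeasure M {x. q < G x} < \<infinity>" if "q \<in> Q" for q
    proof -
      obtain r where r: "q = ennreal (of_rat r)" "0 < r" using \<open>q \<in> Q\<close> by (auto simp: Q_def)
      have "q * emeasure M {x. q < F i x} \<le> s" if i: "i \<in> I" for i
      proof -
        have "q * emeasure M {x. q < F i x} = (\<integral>\<^sup>+x. q * indicator {x. q < F i x} x \<partial>M)"
          using op[OF i] by (simp add: nn_integral_cmult_indicator)
        also have "\<dots> \<le> (\<integral>\<^sup>+x. F i x \<partial>M)"
          by (intro nn_integral_mono) (auto simp: indicator_def)
        also have "\<dots> \<le> s" unfolding s_def using i by (rule SUP_upper)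
        finally show ?thesis .
      qed
      then have "q * emeasure M {x. q < G x} \<le> s"
        by (subst level) (auto simp: SUP_mult_left_ennreal intro!: SUP_least)
      then have "q * emeasure M {x. q < G x} < \<infinity>" using False by (auto simp: top.not_eq_extremum less_top intro: le_less_trans)
      then show ?thesis using r by (auto simp: ennreal_mult_less_top)
    qed
    have "\<exists>f :: nat \<Rightarrow> 'i. range f \<subseteq> I \<and> emeasure M {x. q < G x} = (SUP n. emeasure M {x. q < F (f n) x})" for q
    proof -
      obtain g :: "nat \<Rightarrow> ennreal" where g: "range g \<subseteq> (\<lambda>i. emeasure M {x. q < F i x}) ` I"
        "(SUP i\<in>I. emeasure M {x. q < F i x}) = Sup (range g)"
        using ennreal_SUP_countable_SUP[OF ne, of "\<lambda>i. emeasure M {x. q < F i x}"] by blast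
      have "\<forall>n. \<exists>i. i \<in> I \<and> g n = emeasure M {x. q < F i x}" using g(1) by auto
      from choice[OF this] obtain f where "\<forall>n. f n \<in> I \<and> g n = emeasure M {x. q < F (f n) x}" ..
      then show ?thesis using g(2) by (intro exI[of _ f]) (auto simp: level)
    qed
    then have "\<forall>q. \<exists>f :: nat \<Rightarrow> 'i. range f \<subseteq> I \<and>
        emeasure M {x. q < G x} = (SUP n. emeasure M {x. q < F (f n) x})" ..
    from choice[OF this] obtain f :: "ennreal \<Rightarrow> nat \<Rightarrow> 'i" where f: "\<And>q n. f q n \<in> I"
      "\<And>q. emeasure M {x. q < G x} = (SUP n. emeasure M {x. q < F (f q n) x})"
      by blast
    define J where "J = (\<lambda>(q, n). f q n) ` (Q \<times> UNIV)"
    have "countable J" "J \<noteq> {}" "J \<subseteq> I" using Qc Qne f by (auto simp: J_def)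
    then obtain j :: "nat \<Rightarrow> 'i" where j: "range j = J" using range_from_nat_into[of J] by blast
    then have jI: "j n \<in> I" for n using \<open>J \<subseteq> I\<close> by auto
    have "\<exists>k. \<forall>n. (k n \<in> I \<and> F (j n) \<le> F (k n)) \<and> F (k n) \<le> F (k (Suc n))"
    proof (rule dependent_nat_choice)
      show "\<exists>k. k \<in> I \<and> F (j 0) \<le> F k" using jI by auto
      fix x n assume "x \<in> I \<and> F (j n) \<le> F x"
      then show "\<exists>y. (y \<in> I \<and> F (j (Suc n)) \<le> F y) \<and> F x \<le> F y"
        using dir[OF jI[of "Suc n"], of x] by auto
    qed
    then obtain k where k: "\<And>n. k n \<in> I" "\<And>n. F (j n) \<le> F (k n)" "\<And>n. F (k n) \<le> F (k (Suc n))"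
      by blast
    define H where "H x = (SUP n. F (k n) x)" for x
    have lscH: "lower_semicont H"
      unfolding H_def using k lsc by (intro lower_semicont_SUP) auto
    have "AE x in M. \<not> (q < G x \<and> \<not> q < H x)" if q: "q \<in> Q" for q
    proof -
      have sub: "{x. q < H x} \<subseteq> {x. q < G x}"
        using k(1) by (auto simp: H_def G_def less_SUP_iff)
      have "{x. q < F (f q n) x} \<subseteq> {x. q < H x}" for n
      proof -
        have "f q n \<in> range j" using q j by (auto simp: J_def)
        then obtain m where "f q n = j m" by auto
        then show ?thesis
          using k(2)[of m] by (auto simp: H_def less_SUP_iff le_fun_def intro: less_le_trans)
      qed
      then have "emeasure M {x. q < G x} \<le> emeasure M {x. q < H x}"
        unfolding f(2) using lower_semicontD[OF lscH] sets
        by (intro SUP_least emeasure_mono) auto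
      then have "emeasure M {x. q < G x} = emeasure M {x. q < H x}"
        using sub lower_semicontD[OF lscG] sets by (intro antisym[OF _ emeasure_mono]) auto
      then have "emeasure M ({x. q < G x} - {x. q < H x}) = 0"
        using sub fin[OF q] lower_semicontD[OF lscG] lower_semicontD[OF lscH] sets
        by (subst emeasure_Diff) auto
      moreover have "{x. q < G x} - {x. q < H x} \<in> sets M"
        using lower_semicontD[OF lscG] lower_semicontD[OF lscH] sets by auto
      ultimately have "{x. q < G x} - {x. q < H x} \<in> null_sets M" by auto
      then show ?thesis by (rule AE_I') auto
    qed
    then have "AE x in M. \<forall>q\<in>Q. \<not> (q < G x \<and> \<not> q < H x)"
      using Qc by (auto simp: AE_ball_countable)
    then have "AE x in M. G x \<le> H x"
    proof eventually_elim
      case (elim x)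
      show ?case
      proof (rule ccontr)
        assume "\<not> G x \<le> H x"
        then have "H x < G x" by simp
        then obtain q where q: "H x < ennreal (real_of_rat q)" "ennreal (real_of_rat q) < G x"
          using ennreal_rat_dense by blast
        then have "0 < q" by (intro ccontr[of "0 < q"]) (auto simp: not_less ennreal_neg)
        then have "ennreal (of_rat q) \<in> Q" by (auto simp: Q_def)
        then show False using elim q by auto
      qed
    qed
    then have "(\<integral>\<^sup>+x. G x \<partial>M) \<le> (\<integral>\<^sup>+x. H x \<partial>M)" by (rule nn_integral_mono_AE)
    also have "\<dots> = (SUP n. \<integral>\<^sup>+x. F (k n) x \<partial>M)"
      unfolding H_def using k by (intro nn_integral_monotone_convergence_SUP) (auto intro: incseq_SucI)
    also have "\<dots> \<le> s" unfolding s_def using k by (intro SUP_least SUP_upper)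
    finally show "(\<integral>\<^sup>+x. G x \<partial>M) \<le> s" .
  qed auto
qed

section \<open>Urysohn functions and Fubini for lower semicontinuous integrands\<close>

lemma compact_closure_subset:
  assumes "compact K" "closure A \<subseteq> K"
  shows "compact (closure A)"
  using compact_Int_closed[OF assms(1) closed_closure[of A]] assms(2) by (simp add: Int_absorb1)

lemma locally_compact_open_nbhd:
  fixes x :: "'a::t2_space"
  assumes "locally_compact_space (euclidean :: 'a topology)"
  obtains V where "open V" "x \<in> V" "compact (closure V)"
proof -
  obtain U K where UK: "open U" "compact K" "x \<in> U" "U \<subseteq> K"
    using assms by (auto simp: locally_compact_space_def, blast)
  then have "closure U \<subseteq> K" by (simp add: closure_minimal compact_imp_closed)
  then have "compact (closure U)"
    by (rule compact_closure_subset[OF UK(2)])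
  then show ?thesis using that UK by blast
qed

lemma locally_compact_compact_nbhd:
  fixes C :: "'a::t2_space set"
  assumes lc: "locally_compact_space (euclidean :: 'a topology)" and C: "compact C"
  obtains V where "open V" "C \<subseteq> V" "compact (closure V)"
proof -
  have "\<forall>x::'a. \<exists>V. open V \<and> x \<in> V \<and> compact (closure V)"
  proof
    fix x :: 'a
    obtain V where "open V" "x \<in> V" "compact (closure V)"
      by (rule locally_compact_open_nbhd[OF lc])
    then show "\<exists>V. open V \<and> x \<in> V \<and> compact (closure V)" by blast
  qed
  from choice[OF this] obtain V :: "'a \<Rightarrow> 'a set"
    where V: "\<And>x. open (V x)" "\<And>x. x \<in> V x" "\<And>x. compact (closure (V x))"
    by blast
  have "C \<subseteq> (\<Union>x\<in>UNIV. V x)" using V(2) by blast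
  then obtain F where F: "finite F" "C \<subseteq> (\<Union>x\<in>F. V x)"
    by (rule compactE_image[OF C V(1)])
  show ?thesis
  proof
    show "open (\<Union>x\<in>F. V x)" "C \<subseteq> (\<Union>x\<in>F. V x)" using V F by auto
    have K: "compact (\<Union>x\<in>F. closure (V x))"
      using V(3) F(1) by (intro compact_UN) auto
    have "(\<Union>x\<in>F. V x) \<subseteq> (\<Union>x\<in>F. closure (V x))"
      using closure_subset by blast
    then have "closure (\<Union>x\<in>F. V x) \<subseteq> (\<Union>x\<in>F. closure (V x))"
      by (rule closure_minimal) (rule compact_imp_closed[OF K])
    then show "compact (closure (\<Union>x\<in>F. V x))"
      by (rule compact_closure_subset[OF K])
  qed
qed

lemma locally_compact_Urysohn:
  fixes C :: "'a::t2_space set"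
  assumes lc: "locally_compact_space (euclidean :: 'a topology)"
    and C: "compact C" and U: "open U" "C \<subseteq> U"
  obtains k where "k \<in> Cc" "\<And>x. 0 \<le> k x" "\<And>x. k x \<le> 1" "\<And>x. x \<in> C \<Longrightarrow> k x = 1"
    "\<And>x. x \<notin> U \<Longrightarrow> k x = 0"
proof -
  obtain V where V: "open V" "C \<subseteq> V" "compact (closure V)"
    using locally_compact_compact_nbhd[OF lc C] by blast
  have H: "Hausdorff_space (euclidean :: 'a topology)"
    using hausdorff by (auto simp: Hausdorff_space_def disjnt_def)
  have cr: "completely_regular_space (euclidean :: 'a topology)"
    using lc H locally_compact_Hausdorff_imp_regular_space completely_regular_eq_regular_space
    by metis
  have "closedin euclidean (- (U \<inter> V))" using U V by (auto simp: closed_Compl)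
  moreover have "compactin euclidean C" using C by simp
  moreover have "disjnt C (- (U \<inter> V))" using U V by (auto simp: disjnt_def)
  ultimately obtain k where k: "continuous_map euclidean (subtopology euclidean {0..1::real}) k"
      "k ` (- (U \<inter> V)) \<subseteq> {0}" "k ` C \<subseteq> {1}"
    using Urysohn_completely_regular_compact_closed[OF zero_le_one cr] by metis
  have cont: "continuous_on UNIV k" and r: "\<And>x. k x \<in> {0..1}"
    using k(1) by (auto simp: continuous_map_in_subtopology)
  have "closure {x. k x \<noteq> 0} \<subseteq> closure V" using k(2) by (intro closure_mono) auto
  then have "compact (closure {x. k x \<noteq> 0})"
    by (rule compact_closure_subset[OF V(3)])
  then have "k \<in> Cc" using cont by (simp add: Cc_def)
  then show ?thesis using k r by (intro that[of k]) auto
qed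

lemma Cc_max: "f \<in> Cc \<Longrightarrow> g \<in> Cc \<Longrightarrow> (\<lambda>x. max (f x) (g x)) \<in> Cc"
proof -
  assume f: "f \<in> Cc" and g: "g \<in> Cc"
  have "closure {x. max (f x) (g x) \<noteq> 0} \<subseteq> closure ({x. f x \<noteq> 0} \<union> {x. g x \<noteq> 0})"
    by (intro closure_mono) auto
  moreover have "compact (closure ({x. f x \<noteq> 0} \<union> {x. g x \<noteq> 0}))"
    using f g by (simp add: Cc_def compact_Un)
  ultimately have "compact (closure {x. max (f x) (g x) \<noteq> 0})"
    using compact_closure_subset by blast
  then show ?thesis
    using f g by (auto simp: Cc_def intro: continuous_on_max)
qed

definition bump :: "'a::topological_space set \<Rightarrow> ('a \<Rightarrow> real) set" where
  "bump U = {k \<in> Cc. (\<forall>x. 0 \<le> k x \<and> k x \<le> 1) \<and> (\<forall>x. x \<notin> U \<longrightarrow> k x = 0)}"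

lemma bump_ne: "bump U \<noteq> {}"
proof -
  have "(\<lambda>_. 0) \<in> bump U" by (auto simp: bump_def Cc_def)
  then show ?thesis by auto
qed

lemma bump_directed:
  assumes "k \<in> bump U" "l \<in> bump U"
  shows "\<exists>m\<in>bump U. (\<lambda>x. ennreal (k x)) \<le> (\<lambda>x. ennreal (m x)) \<and> (\<lambda>x. ennreal (l x)) \<le> (\<lambda>x. ennreal (m x))"
proof -
  have "(\<lambda>x. max (k x) (l x)) \<in> bump U"
    using assms by (auto simp: bump_def le_max_iff_disj intro: Cc_max)
  then show ?thesis
    by (intro bexI[of _ "\<lambda>x. max (k x) (l x)"]) (auto simp: le_fun_def intro!: ennreal_leI)
qed

lemma bump_lower_semicont: "k \<in> bump U \<Longrightarrow> lower_semicont (\<lambda>x. ennreal (k x))"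
  by (intro lower_semicont_continuous) (simp add: bump_def Cc_def)

lemma SUP_bump:
  fixes U :: "'a::t2_space set"
  assumes lc: "locally_compact_space (euclidean :: 'a topology)" and U: "open U"
  shows "(SUP k\<in>bump U. ennreal (k x)) = indicator U x"
proof (rule antisym)
  show "(SUP k\<in>bump U. ennreal (k x)) \<le> indicator U x"
    by (intro SUP_least) (auto simp: bump_def indicator_def)
  show "indicator U x \<le> (SUP k\<in>bump U. ennreal (k x))"
  proof (cases "x \<in> U")
    case True
    then obtain k where k: "k \<in> Cc" "\<And>x. 0 \<le> k x" "\<And>x. k x \<le> 1" "k x = 1" "\<And>x. x \<notin> U \<Longrightarrow> k x = 0"
      using locally_compact_Urysohn[OF lc, of "{x}" U] U by auto
    then have "k \<in> bump U" by (auto simp: bump_def)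
    then show ?thesis using k(4) True by (intro SUP_upper2[of k]) auto
  qed auto
qed

lemma emeasure_eq_SUP_bump:
  fixes U :: "'a::t2_space set"
  assumes lc: "locally_compact_space (euclidean :: 'a topology)" and M: "radon M" and U: "open U"
  shows "emeasure M U = (SUP k\<in>bump U. \<integral>\<^sup>+x. ennreal (k x) \<partial>M)"
proof -
  have "emeasure M U = (\<integral>\<^sup>+x. (SUP k\<in>bump U. ennreal (k x)) \<partial>M)"
    using U radon_sets[OF M] by (simp add: SUP_bump[OF lc U])
  also have "\<dots> = (SUP k\<in>bump U. \<integral>\<^sup>+x. ennreal (k x) \<partial>M)"
    by (rule nn_integral_SUP_directed[OF M bump_ne bump_directed bump_lower_semicont])
  finally show ?thesis .
qed

definition box_step :: "(ennreal \<times> 'a set \<times> 'b set) set \<Rightarrow> 'a \<Rightarrow> 'b \<Rightarrow> ennreal" where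
  "box_step I y x = (SUP (c, U, V)\<in>I. c * indicator U y * indicator V x)"

lemma box_step_mono: "I \<subseteq> J \<Longrightarrow> box_step I y x \<le> box_step J y x"
  unfolding box_step_def by (rule SUP_subset_mono) auto

lemma box_step_ge_fst:
  assumes I: "finite I" "\<forall>(c, U, V)\<in>I. open U \<and> open V"
  shows "\<exists>W. open W \<and> y \<in> W \<and> (\<forall>y'\<in>W. \<forall>x. box_step I y x \<le> box_step I y' x)"
proof (intro exI conjI ballI allI)
  let ?W = "\<Inter>(c, U, V)\<in>{(c, U, V)\<in>I. y \<in> U}. U"
  show "open ?W" using I by (intro open_INT) (auto intro: finite_subset)
  show "y \<in> ?W" by auto
  fix y' x assume "y' \<in> ?W"
  then show "box_step I y x \<le> box_step I y' x"
    unfolding box_step_def by (intro SUP_mono) (force simp: indicator_def)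
qed

lemma box_step_ge_snd:
  assumes I: "finite I" "\<forall>(c, U, V)\<in>I. open U \<and> open V"
  shows "\<exists>W. open W \<and> x \<in> W \<and> (\<forall>x'\<in>W. \<forall>y. box_step I y x \<le> box_step I y x')"
proof (intro exI conjI ballI allI)
  let ?W = "\<Inter>(c, U, V)\<in>{(c, U, V)\<in>I. x \<in> V}. V"
  show "open ?W" using I by (intro open_INT) (auto intro: finite_subset)
  show "x \<in> ?W" by auto
  fix x' y assume "x' \<in> ?W"
  then show "box_step I y x \<le> box_step I y x'"
    unfolding box_step_def by (intro SUP_mono) (force simp: indicator_def)
qed

definition boxes_below ::
  "'b measure \<Rightarrow> ('a::topological_space \<Rightarrow> 'b::topological_space \<Rightarrow> ennreal) \<Rightarrow> (ennreal \<times> 'a set \<times> 'b set) set set" where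
  "boxes_below \<omega> G = {I. finite I \<and> (\<forall>(c, U, V)\<in>I. open U \<and> open V \<and> emeasure \<omega> V < \<infinity> \<and>
     (\<forall>y\<in>U. \<forall>x\<in>V. c \<le> G y x))}"

context
  fixes \<mu> :: "'a::topological_space measure" and \<omega> :: "'b::t2_space measure"
    and G :: "'a \<Rightarrow> 'b \<Rightarrow> ennreal"
  assumes lc: "locally_compact_space (euclidean :: 'b topology)"
    and \<omega>: "radon \<omega>" and G: "lower_semicont (\<lambda>(y, x). G y x)"
begin

lemma boxes_below_ne: "boxes_below \<omega> G \<noteq> {}"
proof -
  have "{} \<in> boxes_below \<omega> G" by (simp add: boxes_below_def)
  then show ?thesis by auto
qed

lemma boxes_below_directed:
  assumes "I \<in> boxes_below \<omega> G" "J \<in> boxes_below \<omega> G"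
  shows "I \<union> J \<in> boxes_below \<omega> G"
  using assms by (auto simp: boxes_below_def)

lemma boxes_below_open:
  assumes "I \<in> boxes_below \<omega> G"
  shows "finite I" "\<forall>(c, U, V)\<in>I. open U \<and> open V"
  using assms by (auto simp: boxes_below_def)

lemma lower_semicont_box_step:
  assumes I: "I \<in> boxes_below \<omega> G"
  shows "lower_semicont (\<lambda>y. box_step I y x)" "lower_semicont (\<lambda>x. box_step I y x)"
    and "lower_semicont (\<lambda>x. \<integral>\<^sup>+y. box_step I y x \<partial>M)"
    and "lower_semicont (\<lambda>y. \<integral>\<^sup>+x. box_step I y x \<partial>N)"
proof -
  have 1: "\<exists>W. open W \<and> y \<in> W \<and> (\<forall>y'\<in>W. \<forall>x. box_step I y x \<le> box_step I y' x)" for y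
    by (rule box_step_ge_fst[OF boxes_below_open[OF I]])
  have 2: "\<exists>W. open W \<and> x \<in> W \<and> (\<forall>x'\<in>W. \<forall>y. box_step I y x \<le> box_step I y x')" for x
    by (rule box_step_ge_snd[OF boxes_below_open[OF I]])
  show "lower_semicont (\<lambda>y. box_step I y x)"
  proof (rule lower_semicontI_local)
    fix y from 1[of y] show "\<exists>W. open W \<and> y \<in> W \<and> (\<forall>y'\<in>W. box_step I y x \<le> box_step I y' x)"
      by meson
  qed
  show "lower_semicont (\<lambda>x. box_step I y x)"
  proof (rule lower_semicontI_local)
    fix x from 2[of x] show "\<exists>W. open W \<and> x \<in> W \<and> (\<forall>x'\<in>W. box_step I y x \<le> box_step I y x')"
      by meson
  qed
  show "lower_semicont (\<lambda>x. \<integral>\<^sup>+y. box_step I y x \<partial>M)"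
  proof (rule lower_semicontI_local)
    fix x
    obtain W where "open W" "x \<in> W" "\<And>x' y. x' \<in> W \<Longrightarrow> box_step I y x \<le> box_step I y x'"
      using 2[of x] by blast
    then show "\<exists>W. open W \<and> x \<in> W \<and> (\<forall>x'\<in>W. (\<integral>\<^sup>+y. box_step I y x \<partial>M) \<le> (\<integral>\<^sup>+y. box_step I y x' \<partial>M))"
      by (intro exI[of _ W]) (auto intro!: nn_integral_mono)
  qed
  show "lower_semicont (\<lambda>y. \<integral>\<^sup>+x. box_step I y x \<partial>N)"
  proof (rule lower_semicontI_local)
    fix y
    obtain W where "open W" "y \<in> W" "\<And>x y'. y' \<in> W \<Longrightarrow> box_step I y x \<le> box_step I y' x"
      using 1[of y] by blast
    then show "\<exists>W. open W \<and> y \<in> W \<and> (\<forall>y'\<in>W. (\<integral>\<^sup>+x. box_step I y x \<partial>N) \<le> (\<integral>\<^sup>+x. box_step I y' x \<partial>N))"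
      by (intro exI[of _ W]) (auto intro!: nn_integral_mono)
  qed
qed

lemma SUP_boxes_below: "(SUP I\<in>boxes_below \<omega> G. box_step I y x) = G y x"
proof (rule antisym)
  show "(SUP I\<in>boxes_below \<omega> G. box_step I y x) \<le> G y x"
    unfolding box_step_def
    by (intro SUP_least) (auto simp: boxes_below_def indicator_def)
  show "G y x \<le> (SUP I\<in>boxes_below \<omega> G. box_step I y x)"
  proof (rule dense_le)
    fix c assume "c < G y x"
    then have "(y, x) \<in> {z. c < (case z of (y, x) \<Rightarrow> G y x)}" by simp
    then obtain U V where UV: "open U" "open V" "(y, x) \<in> U \<times> V"
        "U \<times> V \<subseteq> {z. c < (case z of (y, x) \<Rightarrow> G y x)}"
      using open_prod_elim[OF lower_semicontD[OF G, of c]] by metis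
    obtain V' :: "'b set" where V': "open V'" "x \<in> V'" "compact (closure V')"
      using locally_compact_open_nbhd[OF lc] by blast
    have "emeasure \<omega> (V \<inter> V') \<le> emeasure \<omega> (closure V')"
      using closure_subset[of V'] by (intro emeasure_mono) (auto simp: radon_sets[OF \<omega>])
    also have "\<dots> < \<infinity>" using \<omega> V' unfolding radon_def by blast
    finally have "{(c, U, V \<inter> V')} \<in> boxes_below \<omega> G"
      using UV V' by (auto simp: boxes_below_def intro: less_imp_le)
    then show "c \<le> (SUP I\<in>boxes_below \<omega> G. box_step I y x)"
      using UV V' by (intro SUP_upper2[of "{(c, U, V \<inter> V')}"]) (auto simp: box_step_def)
  qed
qed

lemma boxes_below_dir:
  assumes "I \<in> boxes_below \<omega> G" "J \<in> boxes_below \<omega> G"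
    and "\<And>I J. I \<subseteq> J \<Longrightarrow> (F I :: 'c \<Rightarrow> ennreal) \<le> F J"
  shows "\<exists>K\<in>boxes_below \<omega> G. F I \<le> F K \<and> F J \<le> F K"
  using assms boxes_below_directed by (intro bexI[of _ "I \<union> J"]) auto

lemma nn_integral_fst_eq_SUP_boxes:
  assumes \<mu>: "radon \<mu>"
  shows "(\<integral>\<^sup>+y. G y x \<partial>\<mu>) = (SUP I\<in>boxes_below \<omega> G. \<integral>\<^sup>+y. box_step I y x \<partial>\<mu>)"
  unfolding SUP_boxes_below[of _ x, symmetric]
proof (rule nn_integral_SUP_directed[OF \<mu> boxes_below_ne])
  fix I J assume "I \<in> boxes_below \<omega> G" "J \<in> boxes_below \<omega> G"
  then show "\<exists>k\<in>boxes_below \<omega> G. (\<lambda>y. box_step I y x) \<le> (\<lambda>y. box_step k y x) \<and>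
      (\<lambda>y. box_step J y x) \<le> (\<lambda>y. box_step k y x)"
    by (rule boxes_below_dir) (auto simp: le_fun_def box_step_mono)
  show "lower_semicont (\<lambda>y. box_step I y x)" if "I \<in> boxes_below \<omega> G" for I
    by (rule lower_semicont_box_step[OF that])
qed

lemma lower_semicont_nn_integral_fst:
  assumes \<mu>: "radon \<mu>"
  shows "lower_semicont (\<lambda>x. \<integral>\<^sup>+y. G y x \<partial>\<mu>)"
  unfolding nn_integral_fst_eq_SUP_boxes[OF \<mu>]
  by (intro lower_semicont_SUP lower_semicont_box_step)

lemma nn_integral_snd_eq_SUP_boxes:
  "(\<integral>\<^sup>+x. G y x \<partial>\<omega>) = (SUP I\<in>boxes_below \<omega> G. \<integral>\<^sup>+x. box_step I y x \<partial>\<omega>)"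
  unfolding SUP_boxes_below[of y, symmetric]
proof (rule nn_integral_SUP_directed[OF \<omega> boxes_below_ne])
  fix I J assume "I \<in> boxes_below \<omega> G" "J \<in> boxes_below \<omega> G"
  then show "\<exists>k\<in>boxes_below \<omega> G. box_step I y \<le> box_step k y \<and> box_step J y \<le> box_step k y"
    by (rule boxes_below_dir) (auto simp: le_fun_def box_step_mono)
  show "lower_semicont (box_step I y)" if "I \<in> boxes_below \<omega> G" for I
    by (rule lower_semicont_box_step[OF that])
qed

lemma lower_semicont_nn_integral_snd: "lower_semicont (\<lambda>y. \<integral>\<^sup>+x. G y x \<partial>\<omega>)"
  unfolding nn_integral_snd_eq_SUP_boxes by (intro lower_semicont_SUP lower_semicont_box_step)

lemma nn_integral_box_step_swap:
  assumes \<mu>: "radon \<mu>" "finite_measure \<mu>" and I: "I \<in> boxes_below \<omega> G"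
  shows "(\<integral>\<^sup>+x. (\<integral>\<^sup>+y. box_step I y x \<partial>\<mu>) \<partial>\<omega>) = (\<integral>\<^sup>+y. (\<integral>\<^sup>+x. box_step I y x \<partial>\<omega>) \<partial>\<mu>)"
proof -
  define S where "S = (\<Union>(c, U, V)\<in>I. V)"
  have "open S" using I by (auto simp: S_def boxes_below_def)
  then have S [measurable]: "S \<in> sets \<omega>" by (simp add: radon_sets[OF \<omega>])
  have "emeasure \<omega> S \<le> (\<Sum>(c, U, V)\<in>I. emeasure \<omega> V)"
    unfolding S_def case_prod_beta using I
    by (intro emeasure_subadditive_finite) (auto simp: boxes_below_def radon_sets[OF \<omega>])
  also have "\<dots> < \<infinity>" using I by (auto simp: boxes_below_def)
  finally have Sfin: "emeasure \<omega> S < \<infinity>" .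
  define \<omega>' where "\<omega>' = density \<omega> (indicator S)"
  have s': "sets \<omega>' = sets borel" "sets \<mu> = sets borel" "space \<omega>' = UNIV"
    by (simp_all add: \<omega>'_def radon_sets[OF \<omega>] radon_sets[OF \<mu>(1)] radon_space[OF \<omega>])
  interpret \<mu>: finite_measure \<mu> by fact
  interpret \<omega>': finite_measure \<omega>'
  proof
    have "emeasure \<omega>' (space \<omega>') = emeasure \<omega> (S \<inter> space \<omega>)"
      unfolding \<omega>'_def by (simp add: emeasure_restricted)
    then show "emeasure \<omega>' (space \<omega>') \<noteq> \<infinity>" using Sfin by (simp add: radon_space[OF \<omega>])
  qed
  interpret P: pair_sigma_finite \<mu> \<omega>' ..
  have cI: "countable I" using I by (auto simp: boxes_below_def countable_finite)
  have meas: "(\<lambda>(y, x). box_step I y x) \<in> borel_measurable (\<mu> \<Otimes>\<^sub>M \<omega>')"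
  proof -
    have "(\<lambda>z. c * indicator U (fst z) * indicator V (snd z)) \<in> borel_measurable (\<mu> \<Otimes>\<^sub>M \<omega>')"
      if "(c, U, V) \<in> I" for c :: ennreal and U V
    proof -
      have "U \<in> sets \<mu>" "V \<in> sets \<omega>'" using I that s' by (auto simp: boxes_below_def)
      then show ?thesis by measurable
    qed
    then show ?thesis
      unfolding box_step_def case_prod_beta using cI
      by (intro borel_measurable_SUP) auto
  qed
  have red: "(\<integral>\<^sup>+x. f x \<partial>\<omega>') = (\<integral>\<^sup>+x. f x \<partial>\<omega>)"
    if "f \<in> borel_measurable borel" "\<And>x. x \<notin> S \<Longrightarrow> f x = 0" for f
  proof -
    have "(\<integral>\<^sup>+x. f x \<partial>\<omega>') = (\<integral>\<^sup>+x. indicator S x * f x \<partial>\<omega>)"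
      unfolding \<omega>'_def using that(1) borel_open[OF \<open>open S\<close>]
      by (intro nn_integral_density) (auto simp: radon_sets[OF \<omega>] cong: measurable_cong_sets)
    also have "\<dots> = (\<integral>\<^sup>+x. f x \<partial>\<omega>)"
      using that(2) by (intro nn_integral_cong) (auto simp: indicator_def)
    finally show ?thesis .
  qed
  have zero: "box_step I y x = 0" if "x \<notin> S" for x y
    unfolding box_step_def using that
    by (intro antisym SUP_least) (force simp: S_def indicator_def)+
  have meas1: "(\<lambda>x. box_step I y x) \<in> borel_measurable borel" for y
    by (intro lower_semicont_measurable lower_semicont_box_step I)
  have "(\<integral>\<^sup>+x. (\<integral>\<^sup>+y. box_step I y x \<partial>\<mu>) \<partial>\<omega>) = (\<integral>\<^sup>+x. (\<integral>\<^sup>+y. box_step I y x \<partial>\<mu>) \<partial>\<omega>')"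
  proof (rule red[symmetric])
    show "(\<lambda>x. \<integral>\<^sup>+y. box_step I y x \<partial>\<mu>) \<in> borel_measurable borel"
      by (intro lower_semicont_measurable lower_semicont_box_step I)
  qed (simp add: zero)
  also have "\<dots> = (\<integral>\<^sup>+y. (\<integral>\<^sup>+x. box_step I y x \<partial>\<omega>') \<partial>\<mu>)"
    using P.Fubini'[OF meas] by simp
  also have "\<dots> = (\<integral>\<^sup>+y. (\<integral>\<^sup>+x. box_step I y x \<partial>\<omega>) \<partial>\<mu>)"
    by (intro nn_integral_cong red meas1 zero)
  finally show ?thesis .
qed

text \<open>No joint measurability is available here: the Borel sets of the product need not lie in the
  product of the Borel \<open>\<sigma>\<close>-algebras, and \<open>\<omega>\<close> need not be \<open>\<sigma>\<close>-finite. Lower semicontinuous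
  integrands are directed suprema of finite maxima of boxes, for which Fubini is elementary.\<close>

lemma nn_integral_lower_semicont_swap:
  assumes \<mu>: "radon \<mu>" "finite_measure \<mu>"
  shows "(\<integral>\<^sup>+x. (\<integral>\<^sup>+y. G y x \<partial>\<mu>) \<partial>\<omega>) = (\<integral>\<^sup>+y. (\<integral>\<^sup>+x. G y x \<partial>\<omega>) \<partial>\<mu>)"
proof -
  have "(\<integral>\<^sup>+x. (\<integral>\<^sup>+y. G y x \<partial>\<mu>) \<partial>\<omega>) = (SUP I\<in>boxes_below \<omega> G. \<integral>\<^sup>+x. (\<integral>\<^sup>+y. box_step I y x \<partial>\<mu>) \<partial>\<omega>)"
    unfolding nn_integral_fst_eq_SUP_boxes[OF \<mu>(1)]
  proof (rule nn_integral_SUP_directed[OF \<omega> boxes_below_ne _ lower_semicont_box_step(3)])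
    fix I J assume "I \<in> boxes_below \<omega> G" "J \<in> boxes_below \<omega> G"
    then show "\<exists>k\<in>boxes_below \<omega> G. (\<lambda>x. \<integral>\<^sup>+y. box_step I y x \<partial>\<mu>) \<le> (\<lambda>x. \<integral>\<^sup>+y. box_step k y x \<partial>\<mu>) \<and>
      (\<lambda>x. \<integral>\<^sup>+y. box_step J y x \<partial>\<mu>) \<le> (\<lambda>x. \<integral>\<^sup>+y. box_step k y x \<partial>\<mu>)"
      by (rule boxes_below_dir) (auto simp: le_fun_def box_step_mono intro!: nn_integral_mono)
  qed
  also have "\<dots> = (SUP I\<in>boxes_below \<omega> G. \<integral>\<^sup>+y. (\<integral>\<^sup>+x. box_step I y x \<partial>\<omega>) \<partial>\<mu>)"
    by (intro SUP_cong refl nn_integral_box_step_swap \<mu>)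
  also have "\<dots> = (\<integral>\<^sup>+y. (\<integral>\<^sup>+x. G y x \<partial>\<omega>) \<partial>\<mu>)"
    unfolding nn_integral_snd_eq_SUP_boxes
  proof (rule nn_integral_SUP_directed[OF \<mu>(1) boxes_below_ne _ lower_semicont_box_step(4), symmetric])
    fix I J assume "I \<in> boxes_below \<omega> G" "J \<in> boxes_below \<omega> G"
    then show "\<exists>k\<in>boxes_below \<omega> G. (\<lambda>y. \<integral>\<^sup>+x. box_step I y x \<partial>\<omega>) \<le> (\<lambda>y. \<integral>\<^sup>+x. box_step k y x \<partial>\<omega>) \<and>
      (\<lambda>y. \<integral>\<^sup>+x. box_step J y x \<partial>\<omega>) \<le> (\<lambda>y. \<integral>\<^sup>+x. box_step k y x \<partial>\<omega>)"
      by (rule boxes_below_dir) (auto simp: le_fun_def box_step_mono intro!: nn_integral_mono)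
  qed
  finally show "(\<integral>\<^sup>+x. (\<integral>\<^sup>+y. G y x \<partial>\<mu>) \<partial>\<omega>) = (\<integral>\<^sup>+y. (\<integral>\<^sup>+x. G y x \<partial>\<omega>) \<partial>\<mu>)" .
qed

end

section \<open>Hypergroups with Haar measure\<close>

lemma sets_borel_open: "sets borel = sigma_sets UNIV {S. open S}"
  by (simp add: borel_def)

lemma Int_stable_open: "Int_stable {S. open S}"
  by (auto simp: Int_stable_def)

lemma measurable_subprob_algebra_borel:
  fixes K :: "'b \<Rightarrow> 'a::topological_space measure"
  assumes "\<And>x. prob_space (K x)" "\<And>x. sets (K x) = sets borel"
    and "\<And>U. open U \<Longrightarrow> (\<lambda>x. emeasure (K x) U) \<in> borel_measurable M"
  shows "K \<in> measurable M (subprob_algebra borel)"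
  by (rule measurable_subprob_algebra_generated[OF sets_borel_open Int_stable_open])
    (use assms in \<open>auto intro: prob_space_imp_subprob_space\<close>)

lemma prob_measure_eqI_open:
  assumes "prob_space M" "prob_space N" "sets M = sets borel" "sets N = sets borel"
    and "\<And>U. open U \<Longrightarrow> emeasure M U = emeasure N U"
  shows "M = N"
proof (rule measure_eqI_generator_eq[OF Int_stable_open, where \<Omega> = UNIV and A = "\<lambda>_. UNIV"])
  show "emeasure M UNIV \<noteq> \<infinity>"
    using prob_space.emeasure_space_1[OF assms(1)] sets_eq_imp_space_eq[OF assms(3)] by simp
qed (use assms sets_borel_open in auto)

lemma open_null_on_msupp:
  assumes M: "radon M" and U: "open U" "U \<inter> msupp M = {}"
  shows "emeasure M U = 0"
proof -
  have "emeasure M C = 0" if C: "compact C" "C \<subseteq> U" for C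
  proof -
    have "\<forall>x\<in>C. \<exists>W. open W \<and> x \<in> W \<and> emeasure M W = 0"
      using C U by (auto simp: msupp_def)
    then obtain W where W: "\<And>x. x \<in> C \<Longrightarrow> open (W x)" "\<And>x. x \<in> C \<Longrightarrow> x \<in> W x"
        "\<And>x. x \<in> C \<Longrightarrow> emeasure M (W x) = 0"
      by (auto simp: bchoice_iff)
    have "C \<subseteq> (\<Union>x\<in>C. W x)" using W(2) by blast
    then obtain F where F: "F \<subseteq> C" "finite F" "C \<subseteq> (\<Union>x\<in>F. W x)"
      using compactE_image[where S = C and C = C and f = W] C(1) W(1) by metis
    have "(\<Union>x\<in>F. W x) \<in> null_sets M"
      using F W by (intro null_sets_UN' countable_finite)
        (auto simp: null_sets_def radon_sets[OF M])
    then have "emeasure M (\<Union>x\<in>F. W x) = 0" by auto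
    moreover have "emeasure M C \<le> emeasure M (\<Union>x\<in>F. W x)"
      using F W(1) by (intro emeasure_mono) (auto simp: radon_sets[OF M] intro!: borel_open)
    ultimately show ?thesis by simp
  qed
  then show ?thesis
    by (subst radon_emeasure_open[OF M U(1)]) (auto intro!: antisym SUP_least)
qed

lemma closed_msupp: "closed (msupp M)"
proof -
  have "- msupp M = (\<Union>U\<in>{U. open U \<and> emeasure M U = 0}. U)"
    by (auto simp: msupp_def)
  then show ?thesis unfolding closed_def by (simp add: open_Union)
qed

lemma AE_in_msupp:
  assumes "radon M"
  shows "AE x in M. x \<in> msupp M"
proof (rule AE_I')
  show "- msupp M \<in> null_sets M"
    using open_null_on_msupp[OF assms, of "- msupp M"] closed_msupp[of M]
    by (auto simp: null_sets_def radon_sets[OF assms] open_Compl)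
qed auto

locale haar_hypergroup =
  fixes conv :: "'a::t2_space \<Rightarrow> 'a \<Rightarrow> 'a measure" and invol :: "'a \<Rightarrow> 'a" and e :: 'a
    and \<omega> :: "'a measure"
  assumes lc: "locally_compact_space (euclidean :: 'a topology)"
    and hg: "hypergroup conv invol e"
    and haar: "left_haar conv \<omega>"
begin

lemma conv_prob: "prob_space (conv x y)"
  and conv_radon: "radon (conv x y)"
  and conv_compact: "compact (msupp (conv x y))"
  using hg[unfolded hypergroup_def, THEN conjunct1] by auto

lemma conv_sets [simp, measurable_cong]: "sets (conv x y) = sets borel"
  by (rule radon_sets[OF conv_radon])

lemma conv_space [simp]: "space (conv x y) = UNIV"
  by (rule radon_space[OF conv_radon])

lemma conv_UNIV [simp]: "emeasure (conv x y) UNIV = 1"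
  using prob_space.emeasure_space_1[OF conv_prob] by (metis conv_space)

lemma conv_assoc_Cc:
  "f \<in> Cc \<Longrightarrow> (\<integral>u. (\<integral>t. f t \<partial>conv u z) \<partial>conv x y) = (\<integral>v. (\<integral>t. f t \<partial>conv x v) \<partial>conv y z)"
  using hg[unfolded hypergroup_def, THEN conjunct2, THEN conjunct1]
  by simp

lemma conv_continuous: "f \<in> Cc \<Longrightarrow> continuous_on UNIV (\<lambda>(x, y). \<integral>t. f t \<partial>conv x y)"
  using hg[unfolded hypergroup_def, THEN conjunct2, THEN conjunct2, THEN conjunct1]
  by simp

lemma hypergroup_rest:
  "continuous_on UNIV invol \<and> (\<forall>x. invol (invol x) = x)
   \<and> (\<forall>x y. distr (conv x y) borel invol = conv (invol y) (invol x))
   \<and> (\<forall>x y. e \<in> msupp (conv x y) \<longleftrightarrow> x = invol y)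
   \<and> (\<forall>U. open U \<longrightarrow> open {(x, y). msupp (conv x y) \<subseteq> U}
                  \<and> open {(x, y). msupp (conv x y) \<inter> U \<noteq> {}})"
  by (rule hg[unfolded hypergroup_def, THEN conjunct2, THEN conjunct2, THEN conjunct2, THEN conjunct2])

lemma invol_continuous: "continuous_on UNIV invol"
  and invol_invol [simp]: "invol (invol x) = x"
  and distr_invol: "distr (conv x y) borel invol = conv (invol y) (invol x)"
  and unit_in_msupp: "e \<in> msupp (conv x y) \<longleftrightarrow> x = invol y"
  and open_msupp_subset: "open U \<Longrightarrow> open {(x, y). msupp (conv x y) \<subseteq> U}"
  using hypergroup_rest by auto

lemma haar_radon: "radon \<omega>"
  and haar_Cc: "f \<in> Cc \<Longrightarrow> (\<integral>y. (\<integral>t. f t \<partial>conv x y) \<partial>\<omega>) = (\<integral>y. f y \<partial>\<omega>)"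
  using haar unfolding left_haar_def by simp_all

lemma haar_sets [simp, measurable_cong]: "sets \<omega> = sets borel"
  by (rule radon_sets[OF haar_radon])

lemma haar_space [simp]: "space \<omega> = UNIV"
  by (rule radon_space[OF haar_radon])

lemma haar_compact: "compact C \<Longrightarrow> emeasure \<omega> C < \<infinity>"
  using haar_radon[unfolded radon_def, THEN conjunct2, THEN conjunct1] by simp

lemma invol_measurable [measurable]: "invol \<in> borel_measurable borel"
  by (rule borel_measurable_continuous_onI[OF invol_continuous])

lemma compact_invol: "compact C \<Longrightarrow> compact (invol ` C)"
  by (rule compact_continuous_image[OF continuous_on_subset[OF invol_continuous]]) auto

definition cvint :: "('a \<Rightarrow> real) \<Rightarrow> 'a \<Rightarrow> 'a \<Rightarrow> real" where
  "cvint k x y = (\<integral>t. k t \<partial>conv x y)"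

lemma bump_measurable: "k \<in> bump U \<Longrightarrow> k \<in> borel_measurable borel"
  by (intro borel_measurable_continuous_onI) (simp add: bump_def Cc_def)

lemma bump_nonneg: "k \<in> bump U \<Longrightarrow> 0 \<le> k x"
  and bump_le_1: "k \<in> bump U \<Longrightarrow> k x \<le> 1"
  by (auto simp: bump_def)

lemma nn_integral_bump_conv:
  assumes k: "k \<in> bump U"
  shows "(\<integral>\<^sup>+t. ennreal (k t) \<partial>conv x y) = ennreal (cvint k x y)"
    and "0 \<le> cvint k x y" and "cvint k x y \<le> 1"
proof -
  interpret prob_space "conv x y" by (rule conv_prob)
  have int: "integrable (conv x y) k"
    using k bump_measurable[OF k] by (intro integrable_const_bound[of _ 1]) (auto simp: bump_def)
  show "(\<integral>\<^sup>+t. ennreal (k t) \<partial>conv x y) = ennreal (cvint k x y)"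
    unfolding cvint_def using int bump_nonneg[OF k] by (intro nn_integral_eq_integral) auto
  show "0 \<le> cvint k x y" unfolding cvint_def using bump_nonneg[OF k] by simp
  show "cvint k x y \<le> 1"
    unfolding cvint_def using int bump_le_1[OF k] by (intro integral_le_const) auto
qed

lemma cvint_continuous: "k \<in> bump U \<Longrightarrow> continuous_on UNIV (\<lambda>(x, y). cvint k x y)"
  unfolding cvint_def by (intro conv_continuous) (simp add: bump_def)

lemma cvint_continuous_fst:
  assumes k: "k \<in> bump U" shows "continuous_on UNIV (\<lambda>x. cvint k x y)"
  using continuous_on_compose2[OF cvint_continuous[OF k], of UNIV "\<lambda>x. (x, y)"]
  by (simp add: continuous_on_Pair)

lemma cvint_continuous_snd:
  assumes k: "k \<in> bump U" shows "continuous_on UNIV (\<lambda>y. cvint k x y)"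
  using continuous_on_compose2[OF cvint_continuous[OF k], of UNIV "\<lambda>y. (x, y)"]
  by (simp add: continuous_on_Pair)

lemma conv_eq_SUP_cvint:
  "open U \<Longrightarrow> emeasure (conv x y) U = (SUP k\<in>bump U. ennreal (cvint k x y))"
  unfolding emeasure_eq_SUP_bump[OF lc conv_radon]
  by (intro SUP_cong refl nn_integral_bump_conv)

lemma cvint_directed:
  assumes "k \<in> bump U" "l \<in> bump U"
  shows "\<exists>m\<in>bump U. (\<forall>x y. ennreal (cvint k x y) \<le> ennreal (cvint m x y)) \<and>
    (\<forall>x y. ennreal (cvint l x y) \<le> ennreal (cvint m x y))"
proof -
  obtain m where m: "m \<in> bump U" "(\<lambda>x. ennreal (k x)) \<le> (\<lambda>x. ennreal (m x))"
      "(\<lambda>x. ennreal (l x)) \<le> (\<lambda>x. ennreal (m x))"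
    using bump_directed[OF assms] by blast
  have "ennreal (cvint k x y) \<le> ennreal (cvint m x y)" "ennreal (cvint l x y) \<le> ennreal (cvint m x y)" for x y
    using m unfolding nn_integral_bump_conv(1)[OF m(1), symmetric]
      nn_integral_bump_conv(1)[OF assms(1), symmetric] nn_integral_bump_conv(1)[OF assms(2), symmetric]
    by (auto simp: le_fun_def intro!: nn_integral_mono)
  then show ?thesis using m(1) by blast
qed

lemma cvint_directed_fst:
  assumes "k \<in> bump U" "l \<in> bump U"
  shows "\<exists>m\<in>bump U. (\<lambda>x. ennreal (cvint k x y)) \<le> (\<lambda>x. ennreal (cvint m x y)) \<and>
    (\<lambda>x. ennreal (cvint l x y)) \<le> (\<lambda>x. ennreal (cvint m x y))"
  using cvint_directed[OF assms] unfolding le_fun_def by (elim bexE) (rule bexI, auto)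

lemma cvint_directed_snd:
  assumes "k \<in> bump U" "l \<in> bump U"
  shows "\<exists>m\<in>bump U. (\<lambda>y. ennreal (cvint k x y)) \<le> (\<lambda>y. ennreal (cvint m x y)) \<and>
    (\<lambda>y. ennreal (cvint l x y)) \<le> (\<lambda>y. ennreal (cvint m x y))"
  using cvint_directed[OF assms] unfolding le_fun_def by (elim bexE) (rule bexI, auto)

lemma lower_semicont_conv:
  assumes "open U" shows "lower_semicont (\<lambda>(x, y). emeasure (conv x y) U)"
  unfolding conv_eq_SUP_cvint[OF assms] case_prod_beta
  using cvint_continuous by (intro lower_semicont_SUP lower_semicont_continuous) (simp add: case_prod_beta)

lemma lower_semicont_conv_fst:
  assumes "open U" shows "lower_semicont (\<lambda>x. emeasure (conv x y) U)"
  using lower_semicont_compose[OF lower_semicont_conv[OF assms], of "\<lambda>x. (x, y)"]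
  by (simp add: continuous_intros)

lemma lower_semicont_conv_snd:
  assumes "open U" shows "lower_semicont (\<lambda>y. emeasure (conv x y) U)"
  using lower_semicont_compose[OF lower_semicont_conv[OF assms], of "\<lambda>y. (x, y)"]
  by (simp add: continuous_intros)

lemma conv_kernel_fst [measurable]: "(\<lambda>x. conv x y) \<in> borel \<rightarrow>\<^sub>M subprob_algebra borel"
  by (rule measurable_subprob_algebra_borel)
    (auto intro: conv_prob lower_semicont_measurable lower_semicont_conv_fst)

lemma conv_kernel_snd [measurable]: "(\<lambda>y. conv x y) \<in> borel \<rightarrow>\<^sub>M subprob_algebra borel"
  by (rule measurable_subprob_algebra_borel)
    (auto intro: conv_prob lower_semicont_measurable lower_semicont_conv_snd)

lemma bind_kernel:
  assumes "prob_space M" "sets M = sets borel" "K \<in> borel \<rightarrow>\<^sub>M subprob_algebra borel"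
    and K: "\<And>x. prob_space (K x)"
  shows "prob_space (M \<bind> K)" "sets (M \<bind> K) = sets borel"
    and "B \<in> sets borel \<Longrightarrow> emeasure (M \<bind> K) B = (\<integral>\<^sup>+x. emeasure (K x) B \<partial>M)"
    and "f \<in> borel_measurable borel \<Longrightarrow> (\<integral>\<^sup>+t. f t \<partial>(M \<bind> K)) = (\<integral>\<^sup>+x. (\<integral>\<^sup>+t. f t \<partial>K x) \<partial>M)"
proof -
  have ne: "space M \<noteq> {}" using sets_eq_imp_space_eq[OF assms(2)] by simp
  have m: "K \<in> M \<rightarrow>\<^sub>M subprob_algebra borel" using assms(2,3) by (simp cong: measurable_cong_sets)
  show "prob_space (M \<bind> K)"
    using assms(1) K m by (intro prob_space.prob_space_bind[where S = borel]) auto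
  show "sets (M \<bind> K) = sets borel" by (rule sets_bind_measurable[OF m ne])
  show "B \<in> sets borel \<Longrightarrow> emeasure (M \<bind> K) B = (\<integral>\<^sup>+x. emeasure (K x) B \<partial>M)"
    by (rule emeasure_bind[OF ne m])
  show "f \<in> borel_measurable borel \<Longrightarrow> (\<integral>\<^sup>+t. f t \<partial>(M \<bind> K)) = (\<integral>\<^sup>+x. (\<integral>\<^sup>+t. f t \<partial>K x) \<partial>M)"
    by (rule nn_integral_bind[OF _ m])
qed

lemma conv_assoc: "conv x y \<bind> (\<lambda>u. conv u z) = conv y z \<bind> (\<lambda>v. conv x v)"
proof (rule prob_measure_eqI_open)
  note b1 = bind_kernel[OF conv_prob conv_sets conv_kernel_fst conv_prob]
  note b2 = bind_kernel[OF conv_prob conv_sets conv_kernel_snd conv_prob]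
  show "prob_space (conv x y \<bind> (\<lambda>u. conv u z))" "prob_space (conv y z \<bind> (\<lambda>v. conv x v))"
    "sets (conv x y \<bind> (\<lambda>u. conv u z)) = sets borel" "sets (conv y z \<bind> (\<lambda>v. conv x v)) = sets borel"
    by (rule b1 b2)+
  fix U :: "'a set" assume U: "open U"
  have "emeasure (conv x y \<bind> (\<lambda>u. conv u z)) U = (\<integral>\<^sup>+u. (SUP k\<in>bump U. ennreal (cvint k u z)) \<partial>conv x y)"
    using U by (simp add: b1(3) conv_eq_SUP_cvint)
  also have "\<dots> = (SUP k\<in>bump U. \<integral>\<^sup>+u. ennreal (cvint k u z) \<partial>conv x y)"
    by (intro nn_integral_SUP_directed[OF conv_radon bump_ne] lower_semicont_continuous
      cvint_continuous_fst cvint_directed_fst)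
  also have "\<dots> = (SUP k\<in>bump U. \<integral>\<^sup>+v. ennreal (cvint k x v) \<partial>conv y z)"
  proof (intro SUP_cong refl)
    fix k assume k: "k \<in> bump U"
    have 1: "(\<integral>\<^sup>+u. ennreal (g u) \<partial>conv x y) = ennreal (\<integral>u. g u \<partial>conv x y)"
      if "continuous_on UNIV g" "\<And>u. 0 \<le> g u" "\<And>u. g u \<le> 1" for g x y
    proof -
      interpret prob_space "conv x y" by (rule conv_prob)
      have "integrable (conv x y) g"
        using that borel_measurable_continuous_onI[OF that(1)]
        by (intro integrable_const_bound[of _ 1]) auto
      then show ?thesis using that by (intro nn_integral_eq_integral) auto
    qed
    have "(\<integral>u. cvint k u z \<partial>conv x y) = (\<integral>v. cvint k x v \<partial>conv y z)"
      unfolding cvint_def using k by (intro conv_assoc_Cc) (simp add: bump_def)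
    then show "(\<integral>\<^sup>+u. ennreal (cvint k u z) \<partial>conv x y) = (\<integral>\<^sup>+v. ennreal (cvint k x v) \<partial>conv y z)"
      using k by (subst (1 2) 1) (auto intro: cvint_continuous_fst cvint_continuous_snd nn_integral_bump_conv)
  qed
  also have "\<dots> = (\<integral>\<^sup>+v. (SUP k\<in>bump U. ennreal (cvint k x v)) \<partial>conv y z)"
    by (intro nn_integral_SUP_directed[OF conv_radon bump_ne, symmetric] lower_semicont_continuous
      cvint_continuous_snd cvint_directed_snd)
  also have "\<dots> = emeasure (conv y z \<bind> (\<lambda>v. conv x v)) U"
    using U by (simp add: b2(3) conv_eq_SUP_cvint)
  finally show "emeasure (conv x y \<bind> (\<lambda>u. conv u z)) U = emeasure (conv y z \<bind> (\<lambda>v. conv x v)) U" .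
qed

lemma compact_set_conv:
  assumes A: "compact A" and B: "compact B"
  shows "compact (set_conv conv A B)"
  unfolding compact_eq_Heine_Borel
proof (intro allI impI, elim conjE)
  fix C assume C: "\<forall>U\<in>C. open U" "set_conv conv A B \<subseteq> \<Union>C"
  have "\<exists>D. D \<subseteq> C \<and> finite D \<and> msupp (conv (fst z) (snd z)) \<subseteq> \<Union>D" if "z \<in> A \<times> B" for z
  proof -
    have "msupp (conv (fst z) (snd z)) \<subseteq> set_conv conv A B" using that by (auto simp: set_conv_def, blast)
    then have "msupp (conv (fst z) (snd z)) \<subseteq> \<Union>C" using C(2) by (rule order_trans)
    then obtain D where "D \<subseteq> C" "finite D" "msupp (conv (fst z) (snd z)) \<subseteq> \<Union>D"
      by (rule compactE[OF conv_compact]) (use C(1) in auto)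
    then show ?thesis by blast
  qed
  then have "\<forall>z\<in>A \<times> B. \<exists>D. D \<subseteq> C \<and> finite D \<and> msupp (conv (fst z) (snd z)) \<subseteq> \<Union>D" by blast
  from bchoice[OF this] obtain D where
    D': "\<forall>z\<in>A \<times> B. D z \<subseteq> C \<and> finite (D z) \<and> msupp (conv (fst z) (snd z)) \<subseteq> \<Union>(D z)" ..
  have D: "D z \<subseteq> C" "finite (D z)" "msupp (conv (fst z) (snd z)) \<subseteq> \<Union>(D z)" if "z \<in> A \<times> B" for z
    using bspec[OF D' that] by simp_all
  define N where "N z = {(x, y). msupp (conv x y) \<subseteq> \<Union>(D z)}" for z
  have N: "open (N z)" if "z \<in> A \<times> B" for z
    unfolding N_def using D(1)[OF that] C(1) by (intro open_msupp_subset open_Union) auto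
  have "A \<times> B \<subseteq> (\<Union>z\<in>A \<times> B. N z)" using D(3) by (force simp: N_def)
  then obtain F where F: "F \<subseteq> A \<times> B" "finite F" "A \<times> B \<subseteq> (\<Union>z\<in>F. N z)"
    using compactE_image[where S = "A \<times> B" and C = "A \<times> B" and f = N] compact_Times[OF A B] N
    by metis
  show "\<exists>C'\<subseteq>C. finite C' \<and> set_conv conv A B \<subseteq> \<Union>C'"
  proof (intro exI conjI)
    show "(\<Union>z\<in>F. D z) \<subseteq> C" using D(1) F(1) by blast
    show "finite (\<Union>z\<in>F. D z)" using D(2) F by auto
    show "set_conv conv A B \<subseteq> \<Union>(\<Union>z\<in>F. D z)"
    proof
      fix t assume "t \<in> set_conv conv A B"
      then obtain a b where ab: "a \<in> A" "b \<in> B" "t \<in> msupp (conv a b)" by (auto simp: set_conv_def)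
      then obtain z where "z \<in> F" "(a, b) \<in> N z" using F(3) by blast
      then show "t \<in> \<Union>(\<Union>z\<in>F. D z)" using ab(3) by (auto simp: N_def, blast)
    qed
  qed
qed

lemma msupp_conv_swap:
  assumes z: "z \<in> msupp (conv x y)"
  shows "invol y \<in> msupp (conv (invol z) x)"
proof (rule ccontr)
  define P where "P = msupp (conv (invol z) x)"
  assume "invol y \<notin> msupp (conv (invol z) x)"
  then have "e \<notin> set_conv conv P {y}"
    by (auto simp: set_conv_def P_def unit_in_msupp)
  moreover have "compact (set_conv conv P {y})"
    unfolding P_def by (intro compact_set_conv conv_compact) auto
  ultimately have W: "open (- set_conv conv P {y})" "e \<in> - set_conv conv P {y}"
    by (auto simp: compact_imp_closed open_Compl)
  define W where "W = - set_conv conv P {y}"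
  have W: "open W" "e \<in> W" using W by (auto simp: W_def)
  have "emeasure (conv v y) W = 0" if "v \<in> P" for v
    using that by (intro open_null_on_msupp conv_radon W) (auto simp: W_def set_conv_def)
  then have "AE v in conv (invol z) x. emeasure (conv v y) W = 0"
    using AE_in_msupp[OF conv_radon[of "invol z" x]] by (auto simp: P_def)
  then have "(\<integral>\<^sup>+v. emeasure (conv v y) W \<partial>conv (invol z) x) = 0"
    by (subst nn_integral_cong_AE[where v = "\<lambda>_. 0"]) auto
  then have "emeasure (conv (invol z) x \<bind> (\<lambda>v. conv v y)) W = 0"
    using W by (subst bind_kernel(3)[OF conv_prob conv_sets conv_kernel_fst conv_prob]) auto
  then have "(\<integral>\<^sup>+u. emeasure (conv (invol z) u) W \<partial>conv x y) = 0"
    using W unfolding conv_assoc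
    by (subst (asm) bind_kernel(3)[OF conv_prob conv_sets conv_kernel_snd conv_prob]) auto
  then have "AE u in conv x y. emeasure (conv (invol z) u) W = 0"
    using lower_semicont_measurable[OF lower_semicont_conv_snd[OF W(1)]]
    by (subst (asm) nn_integral_0_iff_AE) (auto cong: measurable_cong_sets)
  moreover have "{u. 0 < emeasure (conv (invol z) u) W} \<in> sets (conv x y)"
    using lower_semicontD[OF lower_semicont_conv_snd[OF W(1)]] by simp
  ultimately have "emeasure (conv x y) {u. 0 < emeasure (conv (invol z) u) W} = 0"
    by (subst (asm) AE_iff_measurable) (auto simp: zero_less_iff_neq_zero)
  moreover have "z \<in> {u. 0 < emeasure (conv (invol z) u) W}"
    using unit_in_msupp[of "invol z" z] W by (auto simp: msupp_def zero_less_iff_neq_zero)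
  ultimately show False
    using z lower_semicontD[OF lower_semicont_conv_snd[OF W(1)]] unfolding msupp_def by blast
qed

lemma msupp_conv_swap':
  assumes "z \<in> msupp (conv (invol y) x)"
  shows "y \<in> msupp (conv x (invol z))"
  using msupp_conv_swap[OF msupp_conv_swap[OF assms]] by simp

lemma emeasure_conv_compact_zero:
  assumes "compact C" "C \<inter> msupp (conv x y) = {}"
  shows "emeasure (conv x y) C = 0"
proof -
  have "emeasure (conv x y) (- msupp (conv x y)) = 0"
    by (intro open_null_on_msupp conv_radon) (auto simp: open_Compl closed_msupp)
  moreover have "emeasure (conv x y) C \<le> emeasure (conv x y) (- msupp (conv x y))"
    using assms(2) closed_msupp[of "conv x y"] by (intro emeasure_mono) (auto simp: open_Compl)
  ultimately show ?thesis by simp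
qed

lemma cvint_compact_support:
  assumes k: "k \<in> bump U"
  shows "\<exists>Q. compact Q \<and> (\<forall>y. y \<notin> Q \<longrightarrow> cvint k x y = 0)"
proof -
  define C where "C = closure {t. k t \<noteq> 0}"
  have C: "compact C" using k by (simp add: C_def bump_def Cc_def)
  have "compact (invol ` set_conv conv (invol ` C) {x})"
    by (intro compact_invol compact_set_conv C) auto
  moreover have "cvint k x y = 0" if y: "y \<notin> invol ` set_conv conv (invol ` C) {x}" for y
  proof -
    have "C \<inter> msupp (conv x y) = {}"
    proof (rule ccontr)
      assume "C \<inter> msupp (conv x y) \<noteq> {}"
      then obtain z where "z \<in> C" "z \<in> msupp (conv x y)" by blast
      then have "invol y \<in> set_conv conv (invol ` C) {x}"
        using msupp_conv_swap by (auto simp: set_conv_def)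
      then have "invol (invol y) \<in> invol ` set_conv conv (invol ` C) {x}" by blast
      then show False using y by simp
    qed
    then have "C \<in> null_sets (conv x y)"
      using emeasure_conv_compact_zero[OF C] C by (auto simp: null_sets_def borel_compact)
    then have "AE t in conv x y. t \<notin> C" by (rule AE_not_in)
    then have "AE t in conv x y. k t = 0"
    proof eventually_elim
      case (elim t)
      then show ?case using closure_subset[of "{t. k t \<noteq> 0}"] by (auto simp: C_def)
    qed
    then show "cvint k x y = 0"
      unfolding cvint_def by (rule integral_eq_zero_AE)
  qed
  ultimately show ?thesis by blast
qed

lemma nn_integral_haar_continuous:
  fixes g :: "'a \<Rightarrow> real"
  assumes "continuous_on UNIV g" "\<And>u. 0 \<le> g u" "\<And>u. g u \<le> 1" "compact Q" "\<And>y. y \<notin> Q \<Longrightarrow> g y = 0"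
  shows "(\<integral>\<^sup>+u. ennreal (g u) \<partial>\<omega>) = ennreal (\<integral>u. g u \<partial>\<omega>)"
proof -
  have Q: "Q \<in> sets \<omega>" using assms(4) by (simp add: borel_compact)
  have "integrable \<omega> (indicator Q :: 'a \<Rightarrow> real)"
    using Q haar_compact[OF assms(4)] by (intro integrable_real_indicator)
  then have "integrable \<omega> g"
  proof (rule Bochner_Integration.integrable_bound)
    show "g \<in> borel_measurable \<omega>"
      using borel_measurable_continuous_onI[OF assms(1)] by (simp cong: measurable_cong_sets)
    show "AE x in \<omega>. norm (g x) \<le> norm (indicat_real Q x)"
      using assms(2,3,5) by (auto simp: indicator_def)
  qed
  then show ?thesis using assms(2) by (intro nn_integral_eq_integral) auto
qed

lemma haar_conv_open:
  assumes U: "open U"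
  shows "(\<integral>\<^sup>+y. emeasure (conv x y) U \<partial>\<omega>) = emeasure \<omega> U"
proof -
  have "(\<integral>\<^sup>+y. emeasure (conv x y) U \<partial>\<omega>) = (SUP k\<in>bump U. \<integral>\<^sup>+y. ennreal (cvint k x y) \<partial>\<omega>)"
    unfolding conv_eq_SUP_cvint[OF U]
    by (intro nn_integral_SUP_directed[OF haar_radon bump_ne] lower_semicont_continuous
      cvint_continuous_snd cvint_directed_snd)
  also have "\<dots> = (SUP k\<in>bump U. \<integral>\<^sup>+y. ennreal (k y) \<partial>\<omega>)"
  proof (intro SUP_cong refl)
    fix k assume k: "k \<in> bump U"
    obtain Q where Q: "compact Q" "\<And>y. y \<notin> Q \<Longrightarrow> cvint k x y = 0"
      using cvint_compact_support[OF k, of x] by blast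
    have kc: "k \<in> Cc" using k by (simp add: bump_def)
    have k0: "k y = 0" if "y \<notin> closure {y. k y \<noteq> 0}" for y
      using that closure_subset[of "{y. k y \<noteq> 0}"] by blast
    have "(\<integral>\<^sup>+y. ennreal (cvint k x y) \<partial>\<omega>) = ennreal (\<integral>y. cvint k x y \<partial>\<omega>)"
      by (rule nn_integral_haar_continuous[OF cvint_continuous_snd[OF k] nn_integral_bump_conv(2,3)[OF k] Q])
    also have "\<dots> = ennreal (\<integral>y. k y \<partial>\<omega>)"
      unfolding cvint_def haar_Cc[OF kc] ..
    also have "\<dots> = (\<integral>\<^sup>+y. ennreal (k y) \<partial>\<omega>)"
      by (rule nn_integral_haar_continuous[symmetric, OF _ bump_nonneg[OF k] bump_le_1[OF k] _ k0])
        (use kc in \<open>simp_all add: Cc_def\<close>)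
    finally show "(\<integral>\<^sup>+y. ennreal (cvint k x y) \<partial>\<omega>) = (\<integral>\<^sup>+y. ennreal (k y) \<partial>\<omega>)" .
  qed
  also have "\<dots> = emeasure \<omega> U" by (rule emeasure_eq_SUP_bump[OF lc haar_radon U, symmetric])
  finally show ?thesis .
qed

end

section \<open>Convolution by a probability measure\<close>

lemma radon_outer_approx:
  fixes \<epsilon> :: real
  assumes M: "radon M" and A: "A \<in> sets borel" "emeasure M A < \<infinity>" and \<epsilon>: "0 < \<epsilon>"
  shows "\<exists>U. open U \<and> A \<subseteq> U \<and> emeasure M U < \<infinity> \<and> emeasure M (U - A) < \<epsilon>"
proof -
  have fA: "emeasure M A \<noteq> \<infinity>" using A(2) by simp
  have "emeasure M A = (INF U\<in>{U. open U \<and> A \<subseteq> U}. emeasure M U)"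
    using M[unfolded radon_def, THEN conjunct2, THEN conjunct2, THEN conjunct1] A(1) by (rule bspec)
  from INF_approx_ennreal[OF \<epsilon> this fA] obtain U
    where U: "open U" "A \<subseteq> U" "emeasure M U < emeasure M A + \<epsilon>"
    by auto
  have fin: "emeasure M U < \<infinity>"
    using U(3) by (rule less_le_trans) simp
  have eq: "emeasure M U = emeasure M A + emeasure M (U - A)"
    using U A(1) by (subst plus_emeasure) (auto simp: radon_sets[OF M] Un_absorb1)
  have "emeasure M (U - A) < \<epsilon>"
    using U(3) A(2) unfolding eq by (simp add: ennreal_add_left_cancel_less)
  then show ?thesis using U fin by blast
qed

lemma radon_sandwich:
  fixes \<epsilon> :: real and A :: "'a::t2_space set"
  assumes M: "radon M" and A: "A \<in> sets borel" "emeasure M A < \<infinity>" and \<epsilon>: "0 < \<epsilon>"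
  shows "\<exists>C U. compact C \<and> open U \<and> C \<subseteq> A \<and> A \<subseteq> U \<and> emeasure M U < \<infinity> \<and> emeasure M (U - C) < \<epsilon>"
proof -
  note sets = radon_sets[OF M]
  have \<epsilon>3: "0 < \<epsilon> / 3" using \<epsilon> by simp
  obtain U where U: "open U" "A \<subseteq> U" "emeasure M U < \<infinity>" "emeasure M (U - A) < \<epsilon> / 3"
    using radon_outer_approx[OF M A \<epsilon>3] by blast
  have "{C. compact C \<and> C \<subseteq> U} \<noteq> {}" by (auto intro: exI[of _ "{}"])
  moreover have "emeasure M U \<noteq> \<infinity>" using U(3) by simp
  ultimately have "\<exists>K\<in>{C. compact C \<and> C \<subseteq> U}. emeasure M U < emeasure M K + ennreal (\<epsilon> / 3)"
    by (intro SUP_approx_ennreal[OF \<epsilon>3 _ radon_emeasure_open[OF M U(1)]])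
  then obtain K where K: "compact K" "K \<subseteq> U" "emeasure M U < emeasure M K + ennreal (\<epsilon> / 3)"
    by auto
  have UA: "U - A \<in> sets borel" "emeasure M (U - A) < \<infinity>"
    using U A(1) by (auto intro: less_trans)
  obtain W where W: "open W" "U - A \<subseteq> W" "emeasure M (W - (U - A)) < \<epsilon> / 3"
    using radon_outer_approx[OF M UA \<epsilon>3] by blast
  have Kb: "K \<in> sets borel" using K(1) by (rule borel_compact)
  have eqK: "emeasure M U = emeasure M K + emeasure M (U - K)"
    using U(1) K Kb by (subst plus_emeasure) (auto simp: sets Un_absorb1)
  have "emeasure M K < \<infinity>"
    using U(1) by (intro le_less_trans[OF emeasure_mono[OF K(2)] U(3)]) (simp add: sets)
  then have UK: "emeasure M (U - K) < \<epsilon> / 3"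
    using K(3) unfolding eqK by (simp add: ennreal_add_left_cancel_less)
  have C: "compact (K - W)" using K(1) W(1) by (rule compact_diff)
  have sub: "U - (K - W) \<subseteq> (U - K) \<union> ((U - A) \<union> (W - (U - A)))" by auto
  have "emeasure M (U - (K - W)) \<le> emeasure M ((U - K) \<union> ((U - A) \<union> (W - (U - A))))"
    using U(1) W(1) Kb UA(1) sub by (intro emeasure_mono) (auto simp: sets)
  also have "\<dots> \<le> emeasure M (U - K) + emeasure M ((U - A) \<union> (W - (U - A)))"
    using U(1) W(1) Kb UA(1) by (intro emeasure_subadditive) (auto simp: sets)
  also have "\<dots> \<le> emeasure M (U - K) + (emeasure M (U - A) + emeasure M (W - (U - A)))"
    using U(1) W(1) Kb UA(1) by (intro add_left_mono emeasure_subadditive) (auto simp: sets)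
  also have "\<dots> < ennreal (\<epsilon> / 3) + (ennreal (\<epsilon> / 3) + ennreal (\<epsilon> / 3))"
    by (intro add_strict_mono UK U(4) W(3))
  also have "\<dots> = ennreal \<epsilon>"
    using \<epsilon> by (simp flip: ennreal_plus)
  finally have "emeasure M (U - (K - W)) < \<epsilon>" .
  moreover have "K - W \<subseteq> A" using K(2) W(2) by auto
  ultimately show ?thesis using C U by blast
qed

lemma emeasure_sandwich_le:
  assumes P: "prob_space P" "sets P = sets borel"
    and "C \<in> sets borel" "A \<in> sets borel" "C \<subseteq> A"
  shows "indicator U x * emeasure P (- C) \<le>
    indicator A x * emeasure P (- A) + (indicator (U - A) x + emeasure P (A - C))"
proof (cases "x \<in> A")
  case True
  have "- C = (- A) \<union> (A - C)" using assms(5) by auto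
  then have "emeasure P (- C) \<le> emeasure P (- A) + emeasure P (A - C)"
    using assms by (metis emeasure_subadditive sets.Diff borel_comp)
  moreover have "indicator U x * emeasure P (- C) \<le> emeasure P (- C)" by (auto simp: indicator_def)
  ultimately show ?thesis using True by auto
next
  case False
  have "emeasure P (- C) \<le> 1" using prob_space.emeasure_le_1[OF P(1)] .
  then show ?thesis using False by (auto simp: indicator_def intro: order_trans)
qed

context haar_hypergroup
begin

text \<open>\<open>tr \<mu> x\<close> is the measure against which \<open>h\<close> is integrated to give \<open>(\<mu> * h) x\<close>.\<close>

definition tr :: "'a measure \<Rightarrow> 'a \<Rightarrow> 'a measure" where
  "tr \<mu> x = \<mu> \<bind> (\<lambda>y. conv (invol y) x)"

lemma conv_kernel_invol: "(\<lambda>y. conv (invol y) x) \<in> borel \<rightarrow>\<^sub>M subprob_algebra borel"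
  using measurable_compose[OF invol_measurable conv_kernel_fst] .

lemma lower_semicont_conv_invol:
  assumes "open U" shows "lower_semicont (\<lambda>(y, x). emeasure (conv (invol y) x) U)"
proof -
  have "continuous_on UNIV (\<lambda>z. (invol (fst z), snd z :: 'a))"
    by (intro continuous_on_Pair continuous_on_snd continuous_on_id
        continuous_on_compose2[OF invol_continuous continuous_on_fst]) auto
  from lower_semicont_compose[OF lower_semicont_conv[OF assms] this]
  show ?thesis by (simp add: case_prod_unfold)
qed

context
  fixes \<mu> :: "'a measure"
  assumes \<mu>: "radon \<mu>" "prob_space \<mu>"
begin

lemma
  shows tr_prob: "prob_space (tr \<mu> x)"
    and tr_sets [simp, measurable_cong]: "sets (tr \<mu> x) = sets borel"
    and emeasure_tr: "B \<in> sets borel \<Longrightarrow> emeasure (tr \<mu> x) B = (\<integral>\<^sup>+y. emeasure (conv (invol y) x) B \<partial>\<mu>)"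
    and nn_integral_tr: "f \<in> borel_measurable borel \<Longrightarrow>
      (\<integral>\<^sup>+t. f t \<partial>tr \<mu> x) = (\<integral>\<^sup>+y. (\<integral>\<^sup>+t. f t \<partial>conv (invol y) x) \<partial>\<mu>)"
  unfolding tr_def using bind_kernel[OF \<mu>(2) radon_sets[OF \<mu>(1)] conv_kernel_invol conv_prob] by auto

lemma lower_semicont_tr: "open U \<Longrightarrow> lower_semicont (\<lambda>x. emeasure (tr \<mu> x) U)"
  using lower_semicont_nn_integral_fst[OF lc haar_radon lower_semicont_conv_invol \<mu>(1)]
  by (simp add: emeasure_tr)

lemma tr_kernel: "tr \<mu> \<in> borel \<rightarrow>\<^sub>M subprob_algebra borel"
  by (rule measurable_subprob_algebra_borel)
    (auto intro: tr_prob lower_semicont_measurable lower_semicont_tr)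

lemma tr_measurable:
  assumes "B \<in> sets borel"
  shows "(\<lambda>x. emeasure (tr \<mu> x) B) \<in> borel_measurable \<omega>"
  using measurable_emeasure_kernel[OF tr_kernel assms] by (simp cong: measurable_cong_sets)

lemma nn_integral_tr_measurable:
  assumes "f \<in> borel_measurable borel"
  shows "(\<lambda>x. \<integral>\<^sup>+t. f t \<partial>tr \<mu> x) \<in> borel_measurable \<omega>"
  using measurable_compose[OF tr_kernel nn_integral_measurable_subprob_algebra[OF assms]]
  by (simp cong: measurable_cong_sets)

lemma haar_tr_open:
  assumes U: "open U"
  shows "(\<integral>\<^sup>+x. emeasure (tr \<mu> x) U \<partial>\<omega>) = emeasure \<omega> U"
proof -
  have "(\<integral>\<^sup>+x. emeasure (tr \<mu> x) U \<partial>\<omega>) = (\<integral>\<^sup>+x. (\<integral>\<^sup>+y. emeasure (conv (invol y) x) U \<partial>\<mu>) \<partial>\<omega>)"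
    using U by (simp add: emeasure_tr)
  also have "\<dots> = (\<integral>\<^sup>+y. (\<integral>\<^sup>+x. emeasure (conv (invol y) x) U \<partial>\<omega>) \<partial>\<mu>)"
    using prob_space.axioms(1)[OF \<mu>(2)]
    by (intro nn_integral_lower_semicont_swap[OF lc haar_radon lower_semicont_conv_invol[OF U] \<mu>(1)])
  also have "\<dots> = (\<integral>\<^sup>+y. emeasure \<omega> U \<partial>\<mu>)"
    by (simp add: haar_conv_open[OF U])
  also have "\<dots> = emeasure \<omega> U"
    using prob_space.emeasure_space_1[OF \<mu>(2)] by simp
  finally show ?thesis .
qed

lemma haar_tr_Int:
  assumes V: "open V" "emeasure \<omega> V < \<infinity>" and B: "B \<in> sets borel"
  shows "(\<integral>\<^sup>+x. emeasure (tr \<mu> x) (B \<inter> V) \<partial>\<omega>) = emeasure \<omega> (B \<inter> V)"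
proof -
  have Vb [measurable]: "V \<in> sets borel" using V(1) by simp
  have G: "{S :: 'a set. open S} \<subseteq> Pow UNIV" by auto
  have "B \<in> sigma_sets UNIV {S. open S}" using B by (simp add: sets_borel_open)
  with Int_stable_open G show ?thesis
  proof (induction rule: sigma_sets_induct_disjoint)
    case (basic A)
    then show ?case using V(1) by (intro haar_tr_open) auto
  next
    case empty
    then show ?case by simp
  next
    case (compl A)
    then have A: "A \<in> sets borel" by (simp add: sets_borel_open)
    have fin: "emeasure \<omega> (A \<inter> V) < \<infinity>"
      using A by (intro le_less_trans[OF emeasure_mono V(2)]) auto
    have eq: "emeasure M ((UNIV - A) \<inter> V) = emeasure M V - emeasure M (A \<inter> V)"
      if "sets M = sets borel" "emeasure M (A \<inter> V) < \<infinity>" for M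
    proof -
      have "(UNIV - A) \<inter> V = V - A \<inter> V" by auto
      then show ?thesis using that A by (simp add: emeasure_Diff)
    qed
    have pfin: "emeasure (tr \<mu> x) (A \<inter> V) < \<infinity>" for x
      using prob_space.emeasure_le_1[OF tr_prob] by (rule le_less_trans) simp
    have "(\<integral>\<^sup>+x. emeasure (tr \<mu> x) ((UNIV - A) \<inter> V) \<partial>\<omega>) =
        (\<integral>\<^sup>+x. emeasure (tr \<mu> x) V - emeasure (tr \<mu> x) (A \<inter> V) \<partial>\<omega>)"
      by (intro nn_integral_cong eq tr_sets pfin)
    also have "\<dots> = (\<integral>\<^sup>+x. emeasure (tr \<mu> x) V \<partial>\<omega>) - (\<integral>\<^sup>+x. emeasure (tr \<mu> x) (A \<inter> V) \<partial>\<omega>)"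
      using A fin compl.IH
      by (intro nn_integral_diff tr_measurable) (auto intro!: AE_I2 emeasure_mono)
    also have "\<dots> = emeasure \<omega> V - emeasure \<omega> (A \<inter> V)"
      using compl.IH by (simp add: haar_tr_open[OF V(1)])
    also have "\<dots> = emeasure \<omega> ((UNIV - A) \<inter> V)"
      by (rule eq[symmetric]) (use fin in auto)
    finally show ?case .
  next
    case (union A)
    then have A: "A i \<in> sets borel" for i by (auto simp: sets_borel_open)
    have dis: "disjoint_family (\<lambda>i. A i \<inter> V)"
      using union(1) by (auto simp: disjoint_family_on_def)
    have eq: "emeasure M ((\<Union>i. A i) \<inter> V) = (\<Sum>i. emeasure M (A i \<inter> V))"
      if "sets M = sets borel" for M
      using A that dis by (subst suminf_emeasure) (auto simp: Int_UN_distrib2 image_subset_iff)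
    have "(\<integral>\<^sup>+x. emeasure (tr \<mu> x) ((\<Union>i. A i) \<inter> V) \<partial>\<omega>) = (\<Sum>i. \<integral>\<^sup>+x. emeasure (tr \<mu> x) (A i \<inter> V) \<partial>\<omega>)"
      using A by (simp add: eq nn_integral_suminf tr_measurable)
    also have "\<dots> = emeasure \<omega> ((\<Union>i. A i) \<inter> V)"
      using union.IH by (simp add: eq)
    finally show ?case .
  qed
qed

lemma haar_tr:
  assumes B: "B \<in> sets borel" "emeasure \<omega> B < \<infinity>"
  shows "(\<integral>\<^sup>+x. emeasure (tr \<mu> x) B \<partial>\<omega>) = emeasure \<omega> B"
proof -
  obtain V where "open V" "B \<subseteq> V" "emeasure \<omega> V < \<infinity>"
    using radon_outer_approx[OF haar_radon B zero_less_one] by blast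
  then show ?thesis using haar_tr_Int[of V B] B(1) by (simp add: Int_absorb2)
qed

lemma haar_tr_fun:
  assumes V: "open V" "emeasure \<omega> V < \<infinity>" and h: "h \<in> borel_measurable borel"
  shows "(\<integral>\<^sup>+x. (\<integral>\<^sup>+t. h t * indicator V t \<partial>tr \<mu> x) \<partial>\<omega>) = (\<integral>\<^sup>+x. h x * indicator V x \<partial>\<omega>)"
proof -
  have Vb [measurable]: "V \<in> sets borel" using V(1) by simp
  show ?thesis
    using h
  proof (induction rule: borel_measurable_induct)
    case (cong f g)
    then have "f = g" by auto
    with cong show ?case by simp
  next
    case (set A)
    have "(\<integral>\<^sup>+t. indicator A t * indicator V t \<partial>M) = emeasure M (A \<inter> V)" if "sets M = sets borel" for M
      using set that by (simp flip: indicator_inter_arith add: nn_integral_indicator)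
    then show ?case using haar_tr_Int[OF V set] by simp
  next
    case (mult u c)
    have [measurable]: "(\<lambda>t. u t * indicator V t) \<in> borel_measurable borel" using mult(2) by measurable
    have "(\<integral>\<^sup>+t. c * u t * indicator V t \<partial>M) = c * (\<integral>\<^sup>+t. u t * indicator V t \<partial>M)"
      if "sets M = sets borel" for M
      unfolding mult.assoc
      by (intro nn_integral_cmult) (simp add: that cong: measurable_cong_sets)
    then show ?case
      using mult by (simp add: nn_integral_cmult nn_integral_tr_measurable)
  next
    case (add u v)
    have [measurable]: "(\<lambda>t. u t * indicator V t) \<in> borel_measurable borel"
      "(\<lambda>t. v t * indicator V t) \<in> borel_measurable borel"
      using add by measurable
    have "(\<integral>\<^sup>+t. (v t + u t) * indicator V t \<partial>M) = (\<integral>\<^sup>+t. v t * indicator V t \<partial>M) + (\<integral>\<^sup>+t. u t * indicator V t \<partial>M)"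
      if "sets M = sets borel" for M
      unfolding distrib_right
      by (intro nn_integral_add) (simp_all add: that cong: measurable_cong_sets)
    then show ?case
      using add by (simp add: nn_integral_add nn_integral_tr_measurable)
  next
    case (seq U)
    have mU: "(\<lambda>t. U i t * indicator V t) \<in> borel_measurable borel" for i
      using seq(1)[of i] by measurable
    have inc: "incseq (\<lambda>i t. U i t * indicator V t)"
      using seq(3) by (auto simp: incseq_def le_fun_def intro!: mult_right_mono)
    have eq: "(\<integral>\<^sup>+t. (SUP i. U i) t * indicator V t \<partial>M) = (SUP i. \<integral>\<^sup>+t. U i t * indicator V t \<partial>M)"
      if "sets M = sets borel" for M
    proof -
      have "(\<integral>\<^sup>+t. (SUP i. U i) t * indicator V t \<partial>M) = (\<integral>\<^sup>+t. (SUP i. U i t * indicator V t) \<partial>M)"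
        by (intro nn_integral_cong) (simp add: SUP_mult_right_ennreal image_comp)
      also have "\<dots> = (SUP i. \<integral>\<^sup>+t. U i t * indicator V t \<partial>M)"
        by (intro nn_integral_monotone_convergence_SUP inc) (use mU that in \<open>simp cong: measurable_cong_sets\<close>)
      finally show ?thesis .
    qed
    have "(\<integral>\<^sup>+x. (SUP i. \<integral>\<^sup>+t. U i t * indicator V t \<partial>tr \<mu> x) \<partial>\<omega>) =
        (SUP i. \<integral>\<^sup>+x. (\<integral>\<^sup>+t. U i t * indicator V t \<partial>tr \<mu> x) \<partial>\<omega>)"
      using inc by (intro nn_integral_monotone_convergence_SUP nn_integral_tr_measurable mU)
        (auto simp: incseq_def le_fun_def intro!: nn_integral_mono)
    then show ?case by (simp only: eq[OF tr_sets] eq[OF haar_sets] seq.IH)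
  qed
qed

end

lemma conv_unit: "conv y e = return borel y"
  using hg[unfolded hypergroup_def, THEN conjunct2, THEN conjunct2, THEN conjunct2, THEN conjunct1] by simp

lemma tr_unit: "tr (conv y e) x = conv (invol y) x"
  unfolding tr_def conv_unit by (rule bind_return[OF conv_kernel_invol]) simp

lemma tr_conv: "tr (conv a b) x = conv (invol a) x \<bind> (\<lambda>v. conv (invol b) v)"
proof -
  have "tr (conv a b) x = distr (conv a b) borel invol \<bind> (\<lambda>u. conv u x)"
    unfolding tr_def
    by (rule bind_distr[symmetric, OF _ conv_kernel_fst]) (auto cong: measurable_cong_sets)
  also have "\<dots> = conv (invol a) x \<bind> (\<lambda>v. conv (invol b) v)"
    by (simp add: distr_invol conv_assoc)
  finally show ?thesis .
qed

context
  fixes A :: "'a set"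
  assumes A: "A \<in> sets borel" "emeasure \<omega> A < \<infinity>"
begin

text \<open>\<open>leak \<mu>\<close> is the mass that convolution by \<open>\<mu>\<close> moves out of \<open>A\<close>; as \<open>conv y e\<close> is the point
  mass at \<open>y\<close>, \<open>leak (conv y e)\<close> is the mass moved out by translation by \<open>y\<close>.\<close>

definition leak :: "'a measure \<Rightarrow> ennreal" where
  "leak \<mu> = (\<integral>\<^sup>+x. indicator A x * emeasure (tr \<mu> x) (- A) \<partial>\<omega>)"

lemma leak_approx:
  fixes \<epsilon> :: real
  assumes \<epsilon>: "0 < \<epsilon>"
  shows "\<exists>D. lower_semicont D \<and> (\<forall>y. leak (conv y e) \<le> D y \<and> D y \<le> leak (conv y e) + \<epsilon>) \<and>
    (\<forall>\<mu>. radon \<mu> \<longrightarrow> prob_space \<mu> \<longrightarrow> (\<integral>\<^sup>+y. D y \<partial>\<mu>) \<le> leak \<mu> + \<epsilon>)"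
proof -
  obtain C U where CU: "compact C" "open U" "C \<subseteq> A" "A \<subseteq> U" "emeasure \<omega> (U - C) < \<epsilon>"
    using radon_sandwich[OF haar_radon A \<epsilon>] by blast
  have Cb: "C \<in> sets borel" using CU(1) by (rule borel_compact)
  have oC: "open (- C)" using CU(1) by (simp add: compact_imp_closed open_Compl)
  define Dm where "Dm \<mu> = (\<integral>\<^sup>+x. indicator U x * emeasure (tr \<mu> x) (- C) \<partial>\<omega>)" for \<mu>
  have lower: "leak \<mu> \<le> Dm \<mu>" if \<mu>: "radon \<mu>" "prob_space \<mu>" for \<mu>
    unfolding leak_def Dm_def using CU Cb
    by (intro nn_integral_mono mult_mono emeasure_mono) (auto simp: indicator_def tr_sets[OF \<mu>])
  have upper: "Dm \<mu> \<le> leak \<mu> + \<epsilon>" if \<mu>: "radon \<mu>" "prob_space \<mu>" for \<mu>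
  proof -
    have mt: "(\<lambda>x. emeasure (tr \<mu> x) B) \<in> borel_measurable \<omega>" if "B \<in> sets borel" for B
      by (rule tr_measurable[OF \<mu> that])
    have fin: "emeasure \<omega> (A - C) < \<infinity>"
      using A Cb by (intro le_less_trans[OF emeasure_mono A(2)]) auto
    have "Dm \<mu> \<le> (\<integral>\<^sup>+x. indicator A x * emeasure (tr \<mu> x) (- A) + (indicator (U - A) x + emeasure (tr \<mu> x) (A - C)) \<partial>\<omega>)"
      unfolding Dm_def using A(1) Cb CU(3)
      by (intro nn_integral_mono emeasure_sandwich_le tr_prob[OF \<mu>] tr_sets[OF \<mu>])
    also have "\<dots> = leak \<mu> + (emeasure \<omega> (U - A) + (\<integral>\<^sup>+x. emeasure (tr \<mu> x) (A - C) \<partial>\<omega>))"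
    proof -
      have 1: "(\<lambda>x. indicator A x * emeasure (tr \<mu> x) (- A)) \<in> borel_measurable \<omega>"
        using A(1) by (intro borel_measurable_times_ennreal borel_measurable_indicator mt) auto
      have 2: "U - A \<in> sets \<omega>" "A - C \<in> sets borel" using A(1) CU(2) Cb by auto
      show ?thesis
        unfolding leak_def using 1 2(1) mt[OF 2(2)]
        by (subst nn_integral_add, simp_all) (subst nn_integral_add, simp_all)
    qed
    also have "\<dots> = leak \<mu> + (emeasure \<omega> (U - A) + emeasure \<omega> (A - C))"
      using A(1) Cb fin by (simp add: haar_tr[OF \<mu>])
    also have "emeasure \<omega> (U - A) + emeasure \<omega> (A - C) = emeasure \<omega> (U - C)"
      using A(1) Cb CU by (subst plus_emeasure) (auto intro!: arg_cong[where f = "emeasure \<omega>"])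
    also have "leak \<mu> + emeasure \<omega> (U - C) \<le> leak \<mu> + \<epsilon>"
      using CU(5) by (intro add_left_mono) auto
    finally show ?thesis .
  qed
  have lsc: "lower_semicont (\<lambda>(y, x). indicator U x * emeasure (conv (invol y) x) (- C))"
    using lower_semicont_indicator_times[OF open_Times[OF open_UNIV CU(2)] lower_semicont_conv_invol[OF oC]]
    by (simp add: case_prod_unfold indicator_def mem_Times_iff)
  show ?thesis
  proof (intro exI[of _ "\<lambda>y. Dm (conv y e)"] conjI allI impI)
    show "lower_semicont (\<lambda>y. Dm (conv y e))"
      unfolding Dm_def tr_unit by (rule lower_semicont_nn_integral_snd[OF lc haar_radon lsc])
    show "leak (conv y e) \<le> Dm (conv y e)" "Dm (conv y e) \<le> leak (conv y e) + \<epsilon>" for y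
      by (rule lower upper conv_radon conv_prob)+
    fix \<mu> :: "'a measure" assume \<mu>: "radon \<mu>" "prob_space \<mu>"
    have "(\<integral>\<^sup>+y. Dm (conv y e) \<partial>\<mu>) =
        (\<integral>\<^sup>+x. (\<integral>\<^sup>+y. indicator U x * emeasure (conv (invol y) x) (- C) \<partial>\<mu>) \<partial>\<omega>)"
      unfolding Dm_def tr_unit using prob_space.axioms(1)[OF \<mu>(2)]
      by (intro nn_integral_lower_semicont_swap[OF lc haar_radon lsc \<mu>(1), symmetric])
    also have "\<dots> = Dm \<mu>"
    proof -
      have "(\<lambda>y. emeasure (conv (invol y) x) (- C)) \<in> borel_measurable \<mu>" for x
        using measurable_emeasure_kernel[OF conv_kernel_invol borel_open[OF oC]] radon_sets[OF \<mu>(1)]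
        by (simp cong: measurable_cong_sets)
      then show ?thesis
        unfolding Dm_def using oC by (simp add: nn_integral_cmult emeasure_tr[OF \<mu>])
    qed
    also have "\<dots> \<le> leak \<mu> + \<epsilon>" by (rule upper[OF \<mu>])
    finally show "(\<integral>\<^sup>+y. Dm (conv y e) \<partial>\<mu>) \<le> leak \<mu> + \<epsilon>" .
  qed
qed

lemma lower_semicont_leak: "lower_semicont (\<lambda>y. leak (conv y e))"
  unfolding lower_semicont_def
proof (intro allI, subst open_subopen, intro ballI)
  fix t y assume "y \<in> {y. t < leak (conv y e)}"
  then have ty: "t < leak (conv y e)" by simp
  then obtain s where s: "t < s" "s < leak (conv y e)" using dense by blast
  obtain \<epsilon> :: real where \<epsilon>: "0 < \<epsilon>" "t + \<epsilon> < leak (conv y e)"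
  proof -
    have "t < \<infinity>" "s < \<infinity>" using s by (auto intro: less_le_trans)
    then obtain r r' where r: "t = ennreal r" "0 \<le> r" "s = ennreal r'" "0 \<le> r'"
      by (metis ennreal_cases infinity_ennreal_def less_irrefl)
    then have "0 < r' - r" "t + ennreal (r' - r) = s"
      using s(1) by (auto simp: ennreal_less_iff simp flip: ennreal_plus)
    then show ?thesis using that s(2) by metis
  qed
  obtain D where D: "lower_semicont D" "\<And>y. leak (conv y e) \<le> D y" "\<And>y. D y \<le> leak (conv y e) + \<epsilon>"
    using leak_approx[OF \<epsilon>(1)] by blast
  show "\<exists>T. open T \<and> y \<in> T \<and> T \<subseteq> {y. t < leak (conv y e)}"
  proof (intro exI conjI)
    show "open {z. t + \<epsilon> < D z}" by (rule lower_semicontD[OF D(1)])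
    show "y \<in> {z. t + \<epsilon> < D z}" using less_le_trans[OF \<epsilon>(2) D(2)] by simp
    have "t < leak (conv z e)" if "t + \<epsilon> < D z" for z
    proof -
      have "t + \<epsilon> < leak (conv z e) + \<epsilon>" using that D(3) by (rule less_le_trans)
      then show ?thesis by (simp add: add.commute ennreal_add_left_cancel_less)
    qed
    then show "{z. t + \<epsilon> < D z} \<subseteq> {y. t < leak (conv y e)}" by auto
  qed
qed

lemma leak_zero_on_msupp:
  assumes \<mu>: "radon \<mu>" "prob_space \<mu>" and 0: "leak \<mu> = 0" and y: "y \<in> msupp \<mu>"
  shows "leak (conv y e) = 0"
proof (rule ccontr)
  assume "leak (conv y e) \<noteq> 0"
  have *: "(\<integral>\<^sup>+y. leak (conv y e) \<partial>\<mu>) \<le> 0 + ennreal \<epsilon>" if \<epsilon>: "0 < \<epsilon>" for \<epsilon>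
  proof -
    obtain D where D: "\<forall>y. leak (conv y e) \<le> D y \<and> D y \<le> leak (conv y e) + \<epsilon>"
        "\<forall>\<mu>. radon \<mu> \<longrightarrow> prob_space \<mu> \<longrightarrow> (\<integral>\<^sup>+y. D y \<partial>\<mu>) \<le> leak \<mu> + \<epsilon>"
      using leak_approx[OF \<epsilon>] by (elim exE conjE)
    have "(\<integral>\<^sup>+y. leak (conv y e) \<partial>\<mu>) \<le> (\<integral>\<^sup>+y. D y \<partial>\<mu>)"
      using D(1) by (intro nn_integral_mono) simp
    also have "\<dots> \<le> leak \<mu> + \<epsilon>" using D(2) \<mu> by simp
    finally show ?thesis using 0 by simp
  qed
  have "(\<integral>\<^sup>+y. leak (conv y e) \<partial>\<mu>) \<le> 0"
    by (rule ennreal_le_epsilon) (rule *)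
  then have "(\<integral>\<^sup>+y. leak (conv y e) \<partial>\<mu>) = 0" by simp
  then have "AE y in \<mu>. leak (conv y e) = 0"
    using lower_semicont_measurable[OF lower_semicont_leak] radon_sets[OF \<mu>(1)]
    by (subst (asm) nn_integral_0_iff_AE) (auto cong: measurable_cong_sets)
  moreover have o: "open {y. 0 < leak (conv y e)}" by (rule lower_semicontD[OF lower_semicont_leak])
  ultimately have "emeasure \<mu> {y. 0 < leak (conv y e)} = 0"
    by (subst (asm) AE_iff_measurable) (auto simp: zero_less_iff_neq_zero radon_sets[OF \<mu>(1)] radon_space[OF \<mu>(1)])
  moreover have "y \<in> {y. 0 < leak (conv y e)}"
    using \<open>leak (conv y e) \<noteq> 0\<close> by (simp add: zero_less_iff_neq_zero)
  ultimately show False using y o unfolding msupp_def by blast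
qed

lemma leak_conv_zero:
  assumes a: "leak (conv a e) = 0" and b: "leak (conv b e) = 0"
  shows "leak (conv a b) = 0"
proof -
  have mc: "(\<lambda>x. emeasure (conv z x) B) \<in> borel_measurable borel" if "B \<in> sets borel" for B z
    by (rule measurable_emeasure_kernel[OF conv_kernel_snd that])
  define N where "N = {v \<in> A. 0 < emeasure (conv (invol b) v) (- A)}"
  have N: "N \<in> sets borel"
    unfolding N_def using A(1) mc[of "- A" "invol b"] by measurable
  have AE0: "AE x in \<omega>. indicator A x * emeasure (conv (invol z) x) (- A) = 0" if "leak (conv z e) = 0" for z
    using that A(1) mc[of "- A" "invol z"] unfolding leak_def tr_unit
    by (subst (asm) nn_integral_0_iff_AE) (auto cong: measurable_cong_sets)
  have "emeasure \<omega> N = 0"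
    using AE0[OF b] N by (subst (asm) AE_iff_measurable[of N]) (auto simp: N_def indicator_def zero_less_iff_neq_zero)
  then have "(\<integral>\<^sup>+x. emeasure (conv (invol a) x) N \<partial>\<omega>) = 0"
    using haar_tr[OF conv_radon conv_prob N, of a e] by (simp add: tr_unit)
  then have "AE x in \<omega>. emeasure (conv (invol a) x) N = 0"
    using mc[OF N] by (subst (asm) nn_integral_0_iff_AE) (auto cong: measurable_cong_sets)
  then have "AE x in \<omega>. indicator A x * emeasure (tr (conv a b) x) (- A) = 0"
    using AE0[OF a]
  proof eventually_elim
    case (elim x)
    show ?case
    proof (cases "x \<in> A")
      case True
      have "emeasure (tr (conv a b) x) (- A) = (\<integral>\<^sup>+v. emeasure (conv (invol b) v) (- A) \<partial>conv (invol a) x)"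
        unfolding tr_conv using A(1)
        by (intro bind_kernel(3)[OF conv_prob conv_sets conv_kernel_snd conv_prob]) auto
      also have "\<dots> \<le> (\<integral>\<^sup>+v. indicator (- A) v + indicator N v \<partial>conv (invol a) x)"
      proof (rule nn_integral_mono)
        fix v
        have "emeasure (conv (invol b) v) (- A) \<le> 1" by (rule prob_space.emeasure_le_1[OF conv_prob])
        then show "emeasure (conv (invol b) v) (- A) \<le> indicator (- A) v + indicator N v"
          by (auto simp: indicator_def N_def)
      qed
      also have "\<dots> = emeasure (conv (invol a) x) (- A) + emeasure (conv (invol a) x) N"
        using A(1) N by (subst nn_integral_add) auto
      also have "\<dots> = 0" using elim True by simp
      finally show ?thesis by simp
    qed simp
  qed
  then show ?thesis
    unfolding leak_def by (subst nn_integral_cong_AE[where v = "\<lambda>_. 0"]) auto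
qed

lemma leak_zero_imp_null:
  assumes nc: "\<not> compact (UNIV :: 'a set)" and 0: "\<And>y. leak (conv y e) = 0"
  shows "emeasure \<omega> A = 0"
proof -
  have *: "emeasure \<omega> A \<le> 0 + ennreal \<epsilon>" if \<epsilon>: "0 < \<epsilon>" for \<epsilon>
  proof -
    have \<epsilon>2: "0 < \<epsilon> / 2" using \<epsilon> by simp
    obtain C U where CU: "compact C" "open U" "C \<subseteq> A" "A \<subseteq> U" "emeasure \<omega> (U - C) < ennreal (\<epsilon> / 2)"
      using radon_sandwich[OF haar_radon A \<epsilon>2] by blast
    have Cb: "C \<in> sets borel" using CU(1) by (rule borel_compact)
    have small: "emeasure \<omega> (A - C) \<le> ennreal (\<epsilon> / 2)"
      using A(1) Cb CU by (intro order_trans[OF emeasure_mono less_imp_le[OF CU(5)]]) auto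
    have "compact (set_conv conv C (invol ` C))"
      by (intro compact_set_conv compact_invol CU(1))
    then obtain y where y: "y \<notin> set_conv conv C (invol ` C)"
      using nc by (metis UNIV_eq_I)
    have zero: "emeasure (conv (invol y) x) C = 0" if "x \<in> C" for x
    proof (rule emeasure_conv_compact_zero[OF CU(1)], rule ccontr)
      assume "C \<inter> msupp (conv (invol y) x) \<noteq> {}"
      then obtain z where "z \<in> C" "z \<in> msupp (conv (invol y) x)" by blast
      then have "y \<in> set_conv conv C (invol ` C)"
        using msupp_conv_swap' that by (auto simp: set_conv_def, blast)
      then show False using y by simp
    qed
    have m: "(\<lambda>x. emeasure (conv (invol y) x) B) \<in> borel_measurable \<omega>" if "B \<in> sets borel" for B
      using measurable_emeasure_kernel[OF conv_kernel_snd that] by (simp cong: measurable_cong_sets)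
    have "AE x in \<omega>. indicator A x * emeasure (conv (invol y) x) (- A) = 0"
      using 0[of y] A(1) m[of "- A"] unfolding leak_def tr_unit
      by (subst (asm) nn_integral_0_iff_AE) auto
    then have "AE x in \<omega>. indicator C x \<le> emeasure (conv (invol y) x) (A - C)"
    proof eventually_elim
      case (elim x)
      show ?case
      proof (cases "x \<in> C")
        case True
        then have x0: "emeasure (conv (invol y) x) (- A) = 0" using elim CU(3) by auto
        have "1 = emeasure (conv (invol y) x) ((- A) \<union> (C \<union> (A - C)))"
          using CU(3) by (simp add: Un_absorb1 Compl_partition2)
        also have "\<dots> \<le> emeasure (conv (invol y) x) (- A) + (emeasure (conv (invol y) x) C + emeasure (conv (invol y) x) (A - C))"
          using A(1) Cb by (intro order_trans[OF emeasure_subadditive] add_left_mono emeasure_subadditive) auto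
        also have "\<dots> = emeasure (conv (invol y) x) (A - C)" using x0 zero[OF True] by simp
        finally show ?thesis using True by simp
      qed simp
    qed
    then have "(\<integral>\<^sup>+x. indicator C x \<partial>\<omega>) \<le> (\<integral>\<^sup>+x. emeasure (conv (invol y) x) (A - C) \<partial>\<omega>)"
      by (rule nn_integral_mono_AE)
    also have "\<dots> = emeasure \<omega> (A - C)"
      using haar_tr[OF conv_radon conv_prob, of "A - C" y e] A(1) Cb le_less_trans[OF small]
      by (simp add: tr_unit)
    finally have C: "emeasure \<omega> C \<le> emeasure \<omega> (A - C)" using Cb by simp
    have "emeasure \<omega> A = emeasure \<omega> C + emeasure \<omega> (A - C)"
      using A(1) Cb CU(3) by (subst plus_emeasure) (auto simp: Un_absorb1)
    also have "\<dots> \<le> ennreal (\<epsilon> / 2) + ennreal (\<epsilon> / 2)"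
      using C small by (intro add_mono) auto
    also have "\<dots> = ennreal \<epsilon>" using \<epsilon> by (simp flip: ennreal_plus)
    finally show ?thesis by simp
  qed
  have "emeasure \<omega> A \<le> 0" by (rule ennreal_le_epsilon) (rule *)
  then show ?thesis by simp
qed

end

end

section \<open>Harmonic functions\<close>

context haar_hypergroup
begin

lemma leak_zero_everywhere:
  assumes A: "A \<in> sets borel" "emeasure \<omega> A < \<infinity>"
    and \<sigma>: "radon \<sigma>" "prob_space \<sigma>" "non_degenerate conv \<sigma>" and 0: "leak A \<sigma> = 0"
  shows "leak A (conv y e) = 0"
proof -
  define S where "S = {y. leak A (conv y e) = 0}"
  have "open {y. 0 < leak A (conv y e)}"
    by (rule lower_semicontD[OF lower_semicont_leak[OF A]])
  moreover have "- S = {y. 0 < leak A (conv y e)}" by (auto simp: S_def zero_less_iff_neq_zero)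
  ultimately have "closed S" by (simp add: closed_def)
  have base: "msupp \<sigma> \<subseteq> S"
    using leak_zero_on_msupp[OF A \<sigma>(1,2) 0] by (auto simp: S_def)
  have pow: "set_pow conv (msupp \<sigma>) (Suc n) \<subseteq> S" for n
  proof (induction n)
    case 0
    then show ?case using base by simp
  next
    case (Suc n)
    show ?case
    proof
      fix t assume "t \<in> set_pow conv (msupp \<sigma>) (Suc (Suc n))"
      then obtain a b where ab: "a \<in> set_pow conv (msupp \<sigma>) (Suc n)" "b \<in> msupp \<sigma>" "t \<in> msupp (conv a b)"
        by (auto simp: set_conv_def)
      then have "leak A (conv a e) = 0" "leak A (conv b e) = 0" using Suc base by (auto simp: S_def)
      then have "leak A (conv a b) = 0" by (rule leak_conv_zero[OF A])
      then show "t \<in> S"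
        using leak_zero_on_msupp[OF A conv_radon conv_prob _ ab(3)] by (simp add: S_def)
    qed
  qed
  have "(\<Union>n\<in>{1..}. set_pow conv (msupp \<sigma>) n) \<subseteq> S"
  proof (rule UN_least)
    fix n :: nat assume "n \<in> {1..}"
    then show "set_pow conv (msupp \<sigma>) n \<subseteq> S" using pow[of "n - 1"] by simp
  qed
  then have "closure (\<Union>n\<in>{1..}. set_pow conv (msupp \<sigma>) n) \<subseteq> S"
    using \<open>closed S\<close> by (rule closure_minimal)
  then have "UNIV \<subseteq> S" using \<sigma>(3) by (simp add: non_degenerate_def)
  then show ?thesis by (auto simp: S_def)
qed

lemma norm_mconv_le:
  assumes \<sigma>: "radon \<sigma>" "prob_space \<sigma>" and f: "f \<in> borel_measurable borel"
  shows "ennreal (norm (mconv conv invol \<sigma> f x)) \<le> (\<integral>\<^sup>+t. ennreal (norm (f t)) \<partial>tr \<sigma> x)"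
proof -
  have le: "ennreal (norm (\<integral>t. k t \<partial>M)) \<le> (\<integral>\<^sup>+t. ennreal (norm (k t)) \<partial>M)"
    for k :: "'a \<Rightarrow> complex" and M
    by (cases "integrable M k") (auto simp: not_integrable_integral_eq intro: integral_norm_bound_ennreal)
  have "ennreal (norm (mconv conv invol \<sigma> f x)) \<le> (\<integral>\<^sup>+y. ennreal (norm (fconv conv f (invol y) x)) \<partial>\<sigma>)"
    unfolding mconv_def by (rule le)
  also have "\<dots> \<le> (\<integral>\<^sup>+y. (\<integral>\<^sup>+t. ennreal (norm (f t)) \<partial>conv (invol y) x) \<partial>\<sigma>)"
    unfolding fconv_def by (intro nn_integral_mono le)
  also have "\<dots> = (\<integral>\<^sup>+t. ennreal (norm (f t)) \<partial>tr \<sigma> x)"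
    using f by (intro nn_integral_tr[OF \<sigma>, symmetric]) measurable
  finally show ?thesis .
qed

text \<open>Truncating from below makes a subharmonic function integrable, and the total mass of
  \<open>T h\<close> equals that of \<open>h\<close>; hence \<open>h\<close> is harmonic and no mass is transported into the level set
  from outside.\<close>

lemma leak_level_set_zero:
  assumes \<sigma>: "radon \<sigma>" "prob_space \<sigma>" and p: "1 \<le> p"
    and f: "f \<in> borel_measurable borel" "integrable \<omega> (\<lambda>x. norm (f x) powr p)"
    and harm: "AE x in \<omega>. mconv conv invol \<sigma> f x = f x"
    and c: "0 < c"
  shows "emeasure \<omega> {x. c < norm (f x)} < \<infinity>" and "leak {x. c < norm (f x)} \<sigma> = 0"
proof -
  define A where "A = {x. c < norm (f x)}"
  define h where "h x = ennreal (norm (f x) - c)" for x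
  note [measurable] = f(1)
  have Ab [measurable]: "A \<in> sets borel" unfolding A_def by measurable
  have hb [measurable]: "h \<in> borel_measurable borel" unfolding h_def by measurable
  have Ip: "(\<integral>\<^sup>+x. ennreal (norm (f x) powr p) \<partial>\<omega>) < \<infinity>"
    using f(2) by (auto simp: integrable_iff_bounded)
  have hA: "h x = 0 \<longleftrightarrow> x \<notin> A" for x
    by (auto simp: h_def A_def ennreal_eq_0_iff)
  have bound: "norm (f x) \<le> c * (norm (f x) powr p / c powr p)" if "x \<in> A" for x
  proof -
    have r: "1 \<le> norm (f x) / c" using that c by (simp add: A_def)
    then have "(norm (f x) / c) powr 1 \<le> (norm (f x) / c) powr p" using p by (intro powr_mono) auto
    then have "norm (f x) / c \<le> norm (f x) powr p / c powr p"
      using r c by (simp add: powr_divide)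
    then show ?thesis using c by (simp add: field_simps)
  qed
  have Afin: "emeasure \<omega> A < \<infinity>"
  proof -
    have "ennreal (c powr p) * emeasure \<omega> A = (\<integral>\<^sup>+x. ennreal (c powr p) * indicator A x \<partial>\<omega>)"
      by (simp add: nn_integral_cmult_indicator)
    also have "\<dots> \<le> (\<integral>\<^sup>+x. ennreal (norm (f x) powr p) \<partial>\<omega>)"
      using c p by (intro nn_integral_mono) (auto simp: indicator_def A_def intro!: ennreal_leI powr_mono2)
    finally have "ennreal (c powr p) * emeasure \<omega> A < \<infinity>" using Ip by (rule le_less_trans)
    then show ?thesis using c by (auto simp: ennreal_mult_less_top)
  qed
  then show "emeasure \<omega> {x. c < norm (f x)} < \<infinity>" by (simp add: A_def)
  have hfin: "(\<integral>\<^sup>+x. h x \<partial>\<omega>) < \<infinity>"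
  proof -
    have "(\<integral>\<^sup>+x. h x \<partial>\<omega>) \<le> (\<integral>\<^sup>+x. ennreal (c / c powr p) * ennreal (norm (f x) powr p) \<partial>\<omega>)"
    proof (rule nn_integral_mono)
      fix x
      show "h x \<le> ennreal (c / c powr p) * ennreal (norm (f x) powr p)"
      proof (cases "x \<in> A")
        case True
        have "norm (f x) - c \<le> c / c powr p * norm (f x) powr p" using bound[OF True] c by simp
        then show ?thesis using c by (simp add: h_def ennreal_leI flip: ennreal_mult')
      qed (simp add: hA[THEN iffD2])
    qed
    also have "\<dots> = ennreal (c / c powr p) * (\<integral>\<^sup>+x. ennreal (norm (f x) powr p) \<partial>\<omega>)"
      using f(2) by (intro nn_integral_cmult) auto
    also have "\<dots> < \<infinity>" using Ip by (simp add: ennreal_mult_less_top)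
    finally show ?thesis .
  qed
  obtain V where V: "open V" "A \<subseteq> V" "emeasure \<omega> V < \<infinity>"
    using radon_outer_approx[OF haar_radon Ab Afin zero_less_one] by blast
  define T where "T x = (\<integral>\<^sup>+t. h t \<partial>tr \<sigma> x)" for x
  have mT: "T \<in> borel_measurable \<omega>"
    unfolding T_def by (rule nn_integral_tr_measurable[OF \<sigma> hb])
  have hV: "h t * indicator V t = h t" for t
    using V(2) hA[of t] by (auto simp: indicator_def)
  have IT: "(\<integral>\<^sup>+x. T x \<partial>\<omega>) = (\<integral>\<^sup>+x. h x \<partial>\<omega>)"
    using haar_tr_fun[OF \<sigma> V(1,3) hb] by (simp add: hV T_def)
  have sub: "AE x in \<omega>. h x \<le> T x"
    using harm
  proof eventually_elim
    case (elim x)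
    have "ennreal (norm (f x)) \<le> (\<integral>\<^sup>+t. ennreal (norm (f t)) \<partial>tr \<sigma> x)"
      using norm_mconv_le[OF \<sigma> f(1), of x] elim by simp
    also have "\<dots> \<le> (\<integral>\<^sup>+t. ennreal c + h t \<partial>tr \<sigma> x)"
    proof (rule nn_integral_mono)
      fix t
      show "ennreal (norm (f t)) \<le> ennreal c + h t"
      proof (cases "c \<le> norm (f t)")
        case True
        then show ?thesis using c by (simp add: h_def flip: ennreal_plus)
      next
        case False
        then show ?thesis by (intro add_increasing2) (auto intro: ennreal_leI)
      qed
    qed
    also have "\<dots> = ennreal c + T x"
    proof -
      have "h \<in> borel_measurable (tr \<sigma> x)"
        using hb tr_sets[OF \<sigma>] by (simp cong: measurable_cong_sets)
      then have "(\<integral>\<^sup>+t. ennreal c + h t \<partial>tr \<sigma> x) = (\<integral>\<^sup>+t. ennreal c \<partial>tr \<sigma> x) + T x"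
        unfolding T_def by (intro nn_integral_add) auto
      then show ?thesis
        using prob_space.emeasure_space_1[OF tr_prob[OF \<sigma>]] by simp
    qed
    finally have "ennreal (norm (f x)) - ennreal c \<le> T x"
      by (simp add: ennreal_minus_le_iff)
    then show ?case using c by (simp add: h_def ennreal_minus)
  qed
  have "(\<integral>\<^sup>+x. T x - h x \<partial>\<omega>) = (\<integral>\<^sup>+x. T x \<partial>\<omega>) - (\<integral>\<^sup>+x. h x \<partial>\<omega>)"
    using hb hfin sub mT by (intro nn_integral_diff) (auto cong: measurable_cong_sets)
  also have "\<dots> = 0" using hfin by (simp add: IT)
  finally have "AE x in \<omega>. T x - h x = 0"
    using mT hb by (subst (asm) nn_integral_0_iff_AE) (auto cong: measurable_cong_sets)
  then have out: "AE x in \<omega>. emeasure (tr \<sigma> x) A \<le> indicator A x * emeasure (tr \<sigma> x) A"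
  proof eventually_elim
    case (elim x)
    show ?case
    proof (cases "x \<in> A")
      case False
      then have "h x = 0" by (simp add: hA)
      then have "T x = 0" using elim by simp
      have hm: "h \<in> borel_measurable (tr \<sigma> x)"
        using hb tr_sets[OF \<sigma>] by (simp cong: measurable_cong_sets)
      have "emeasure (tr \<sigma> x) {t \<in> space (tr \<sigma> x). h t \<noteq> 0} = 0"
        using \<open>T x = 0\<close> unfolding T_def by (simp add: nn_integral_0_iff[OF hm])
      moreover have "{t \<in> space (tr \<sigma> x). h t \<noteq> 0} = A"
        using sets_eq_imp_space_eq[OF tr_sets[OF \<sigma>, of x]] by (auto simp: hA)
      ultimately show ?thesis by simp
    qed simp
  qed
  have mt: "(\<lambda>x. indicator A x * emeasure (tr \<sigma> x) B) \<in> borel_measurable \<omega>" if "B \<in> sets borel" for B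
    using Ab by (intro borel_measurable_times_ennreal borel_measurable_indicator tr_measurable[OF \<sigma> that]) simp
  have "emeasure \<omega> A = (\<integral>\<^sup>+x. emeasure (tr \<sigma> x) A \<partial>\<omega>)"
    using haar_tr[OF \<sigma> Ab Afin] by simp
  also have "\<dots> \<le> (\<integral>\<^sup>+x. indicator A x * emeasure (tr \<sigma> x) A \<partial>\<omega>)"
    by (rule nn_integral_mono_AE[OF out])
  finally have "emeasure \<omega> A + leak A \<sigma> \<le> (\<integral>\<^sup>+x. indicator A x * emeasure (tr \<sigma> x) A \<partial>\<omega>) + leak A \<sigma>"
    by (rule add_right_mono)
  also have "\<dots> = (\<integral>\<^sup>+x. indicator A x * emeasure (tr \<sigma> x) A + indicator A x * emeasure (tr \<sigma> x) (- A) \<partial>\<omega>)"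
    unfolding leak_def[OF Ab Afin] using mt[OF Ab] mt[of "- A"] Ab
    by (intro nn_integral_add[symmetric]) auto
  also have "\<dots> = (\<integral>\<^sup>+x. indicator A x \<partial>\<omega>)"
  proof (rule nn_integral_cong)
    fix x
    have sp: "space (tr \<sigma> x) = UNIV" using sets_eq_imp_space_eq[OF tr_sets[OF \<sigma>, of x]] by simp
    have "emeasure (tr \<sigma> x) A + emeasure (tr \<sigma> x) (- A) = emeasure (tr \<sigma> x) (A \<union> - A)"
      using Ab tr_sets[OF \<sigma>] by (intro plus_emeasure) auto
    then have "emeasure (tr \<sigma> x) A + emeasure (tr \<sigma> x) (- A) = 1"
      using prob_space.emeasure_space_1[OF tr_prob[OF \<sigma>], of x] sp by simp
    then show "indicator A x * emeasure (tr \<sigma> x) A + indicator A x * emeasure (tr \<sigma> x) (- A) = indicator A x"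
      by (simp flip: distrib_left)
  qed
  also have "\<dots> = emeasure \<omega> A + 0" by simp
  finally have "leak A \<sigma> \<le> 0"
    using Afin by (simp only: ennreal_add_left_cancel_le) auto
  then show "leak {x. c < norm (f x)} \<sigma> = 0" by (simp add: A_def)
qed

end

theorem theorem4p10:
  fixes conv :: "'a::t2_space \<Rightarrow> 'a \<Rightarrow> 'a measure"
    and invol :: "'a \<Rightarrow> 'a" and e :: 'a
    and \<omega> \<sigma> :: "'a measure" and p :: real
  assumes "locally_compact_space (euclidean :: 'a topology)"
    and "hypergroup conv invol e"
    and "\<not> compact (UNIV :: 'a set)"
    and "left_haar conv \<omega>"
    and "prob_space \<sigma>" and "radon \<sigma>"
    and "non_degenerate conv \<sigma>"
    and "1 < p"
    and "f \<in> Hp conv invol \<omega> p \<sigma>"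
  shows "AE x in \<omega>. f x = 0"
proof -
  interpret haar_hypergroup conv invol e \<omega>
    using assms(1,2,4) by unfold_locales
  have f: "f \<in> borel_measurable borel" "integrable \<omega> (\<lambda>x. norm (f x) powr p)"
      "AE x in \<omega>. mconv conv invol \<sigma> f x = f x"
    using assms(9) by (auto simp: Hp_def)
  have "AE x in \<omega>. \<not> c < norm (f x)" if c: "0 < c" for c
  proof -
    define A where "A = {x. c < norm (f x)}"
    have A: "A \<in> sets borel" unfolding A_def using f(1) by measurable
    have fin: "emeasure \<omega> A < \<infinity>" and 0: "leak A \<sigma> = 0"
      unfolding A_def using leak_level_set_zero[OF assms(6,5) less_imp_le[OF assms(8)] f c] by auto
    have "emeasure \<omega> A = 0"
      by (rule leak_zero_imp_null[OF A fin assms(3)])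
        (rule leak_zero_everywhere[OF A fin assms(6,5,7) 0])
    then have "A \<in> null_sets \<omega>" using A by (simp add: null_sets_def)
    then show ?thesis by (rule AE_I') (auto simp: A_def)
  qed
  then have "AE x in \<omega>. \<not> 1 / real (Suc n) < norm (f x)" for n by simp
  then have "AE x in \<omega>. \<forall>n. \<not> 1 / real (Suc n) < norm (f x)" by (simp add: AE_all_countable)
  then show ?thesis
  proof eventually_elim
    case (elim x)
    show ?case
    proof (rule ccontr)
      assume "f x \<noteq> 0"
      then obtain n where "inverse (real (Suc n)) < norm (f x)"
        using reals_Archimedean[of "norm (f x)"] by auto
      then show False using elim by (simp add: inverse_eq_divide)
    qed
  qed
qed

end
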